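(* Let $n\ge0$ be even. Then: 1. $w_n=(-1)^{[n/4]}\,T_{n\alpha_1/2}(v_{\Lambda_0})$. 2. Given an integer $k$ with $0\le k\le n$, let $\gamma=(k-n/2)\alpha_1$. Then $(-1)^{[n/4]}w_n=(-1)^{[(n-k)/2]}\,T_\gamma(w_{2(n-k)})$. 3. Given $\xi=(n,k,\lambda)\in\mathfrak{P}^{\mathrm{stab}}(n)$, let $\xi^\dagger=(2(n-k),n-k,\lambda)$ and $\gamma(\xi)=(k-n/2)\alpha_1$. Then $\xi^\dagger\in\mathfrak{P}^{\mathrm{stab}}(2(n-k))$ and $$\mathfrak{c}(\xi)=T_{\gamma(\xi)}\big(\mathfrak{c}(\xi^\dagger)\big).$$
   Context: Affine Lie algebra. $\mathfrak{sl}_2$ is the complex Lie algebra of trace-zero $2\times2$ matrices with standard basis $x=\begin{pmatrix}0&1\\0&0\end{pmatrix}$, $h=\begin{pmatrix}1&0\\0&-1\end{pmatrix}$, $y=\begin{pmatrix}0&0\\1&0\end{pmatrix}$ and form $(A,B)=\mathrm{trace}(AB)$. $\widehat{\mathfrak{sl}_2}=\mathfrak{sl}_2\otimes\mathbb{C}[t,t^{-1}]\oplus\mathbb{C}c\oplus\mathbb{C}d$, where $At^m$ means $A\otimes t^m$, $c$ is central, $[At^m,Bt^n]=[A,B]t^{m+n}+m\,\delta_{m,-n}(A,B)c$ and $[d,At^m]=mAt^m$. Chevalley generators: $e_1=x$, $f_1=y$, $e_0=yt$, $f_0=xt^{-1}$; simple coroots $\alpha_1^\vee=h$, $\alpha_0^\vee=c-h$.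 On $\widehat{\mathfrak h}=\mathbb{C}h\oplus\mathbb{C}c\oplus\mathbb{C}d$ the functionals $\alpha_1,\delta,\Lambda_0$ take on $(h,c,d)$ the values $(2,0,0)$, $(0,0,1)$, $(0,1,0)$. $L(\Lambda_0)$ is the irreducible $\widehat{\mathfrak{sl}_2}$-module with highest weight $\Lambda_0$ and highest weight vector $v_{\Lambda_0}$. Translation operators (Frenkel-Kac) on $L(\Lambda_0)$. Put $E_{\alpha_1}=x$, $E_{-\alpha_1}=y$, and for a real root $\alpha=\gamma+k\delta$ ($\gamma\in\{\alpha_1,-\alpha_1\}$, $k\in\mathbb{Z}$) put $E_\alpha=E_\gamma t^k$. On $L(\Lambda_0)$ define the linear automorphism $r_\alpha=e^{-E_\alpha}e^{E_{-\alpha}}e^{-E_\alpha}$ (well defined since the $E_{\pm\alpha}$ act locally nilpotently). For $\gamma\in\{\alpha_1,-\alpha_1\}$ let $T_\gamma=r_{\delta-\gamma}\,r_\gamma$, and $T_{p\gamma}=(T_\gamma)^p$ for integers $p\ge0$. This defines $T_\beta$ for all $\beta\in\mathbb{Z}\alpha_1$. Divided powers: $X^{(p)}=X^p/p!$. For even $n\ge0$, $w_n=(xt^{-n/2})^{(n/2)}v_{\Lambda_0}$. A partition $\lambda=(\lambda_1\ge\lambda_2\ge\cdots)$ is a weakly decreasing sequence of non-negative integers, eventually zero; $|\lambda|=\sum_i\lambda_i$; $\mathrm{supp}\,\lambda$ is the number of non-zero parts. $\mathfrak{P}(n)$ is the set of triples $(n,k,\lambda)$ with $k$ an integer, $0\le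 k\le n$, and $\lambda$ a partition with $\lambda_1\le k$ and $\mathrm{supp}\,\lambda\le n-k$. For $n$ even, $\mathfrak{P}^{\mathrm{stab}}(n)=\{(n,k,\lambda)\in\mathfrak{P}(n):|\lambda|\le\min(n-k,k)\}$, and for $\xi=(n,k,\lambda)\in\mathfrak{P}(n)$ $$\mathfrak{c}(\xi)=z(\xi)\Big(\prod_{i=1}^{n-k}yt^{k-\lambda_i}\Big)w_n\in L(\Lambda_0),\qquad z(\xi)=\frac{(-1)^{[n/4]-[(n-k)/2]}}{\prod_{j=0}^k m_j!},$$ where $[\cdot]$ is the floor function, $m_j=\#\{i:\lambda_i=j\}$ for $j\ge1$, and $m_0=n-k-\mathrm{supp}\,\lambda$. *)

theory Defs
  imports "HOL-Analysis.Analysis"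
begin

section \<open>The affine Lie algebra\<close>

definition sl2 :: "(complex^2^2) set"
  where "sl2 = {A. trace A = 0}"

definition mat_x :: "complex^2^2"
  where "mat_x = vector [vector [0, 1], vector [0, 0]]"

definition mat_h :: "complex^2^2"
  where "mat_h = vector [vector [1, 0], vector [0, -1]]"

definition mat_y :: "complex^2^2"
  where "mat_y = vector [vector [0, 0], vector [1, 0]]"

definition commutator :: "complex^2^2 \<Rightarrow> complex^2^2 \<Rightarrow> complex^2^2"
  where "commutator A B = A ** B - B ** A"

definition smat :: "complex \<Rightarrow> complex^2^2 \<Rightarrow> complex^2^2"
  where "smat s A = map_matrix ((*) s) A"

text \<open>
  \<open>Aff a \<mu> \<nu>\<close> stands for \<open>(\<Sum>m. a m \<otimes> t\<^sup>m) + \<mu> c + \<nu> d\<close>; it belongs to the Lie algebra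
  when \<open>a\<close> is finitely supported with values in \<open>sl2\<close>.
\<close>

datatype aff = Aff (loop: "int \<Rightarrow> complex^2^2") (c_coeff: complex) (d_coeff: complex)

definition affine_sl2 :: "aff set"
  where "affine_sl2 = {a. (\<forall>m. loop a m \<in> sl2) \<and> finite {m. loop a m \<noteq> 0}}"

definition aff_add :: "aff \<Rightarrow> aff \<Rightarrow> aff"
  where "aff_add a b =
    Aff (\<lambda>m. loop a m + loop b m) (c_coeff a + c_coeff b) (d_coeff a + d_coeff b)"

definition aff_scale :: "complex \<Rightarrow> aff \<Rightarrow> aff"
  where "aff_scale s a = Aff (\<lambda>m. smat s (loop a m)) (s * c_coeff a) (s * d_coeff a)"

text \<open>
  The bilinear extension of \<open>[A t\<^sup>m, B t\<^sup>n] = [A, B] t\<^bsup>m+n\<^esup> + m \<delta>\<^bsub>m,-n\<^esub> trace(A B) c\<close>,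
  \<open>[d, A t\<^sup>m] = m A t\<^sup>m\<close>, \<open>c\<close> central; the lemmas below recover these relations.
\<close>

definition aff_bracket :: "aff \<Rightarrow> aff \<Rightarrow> aff"
  where "aff_bracket a b = Aff
    (\<lambda>k. (\<Sum>m | loop a m \<noteq> 0. commutator (loop a m) (loop b (k - m)))
       + smat (d_coeff a * of_int k) (loop b k) - smat (d_coeff b * of_int k) (loop a k))
    (\<Sum>m | loop a m \<noteq> 0. of_int m * trace (loop a m ** loop b (- m)))
    0"

definition tpow :: "complex^2^2 \<Rightarrow> int \<Rightarrow> aff"
  where "tpow A m = Aff (\<lambda>k. if k = m then A else 0) 0 0"

definition aff_c :: aff
  where "aff_c = Aff (\<lambda>_. 0) 1 0"

definition aff_d :: aff
  where "aff_d = Aff (\<lambda>_. 0) 0 1"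

lemma bracket_tpow_tpow:
  "aff_bracket (tpow A m) (tpow B n) =
    aff_add (tpow (commutator A B) (m + n))
      (aff_scale (if m = - n then of_int m * trace (A ** B) else 0) aff_c)"
proof -
  have zero: "commutator 0 C = 0" "commutator C 0 = 0" "smat s 0 = 0" "smat 0 C = 0" for C s
    by (simp_all add: commutator_def smat_def map_matrix_def vec_eq_iff)
  have supp: "{k. loop (tpow A m) k \<noteq> 0} = (if A = 0 then {} else {m})"
    by (auto simp: tpow_def)
  have tr0: "trace (0 :: complex^2^2) = 0"
    by (simp add: trace_def)
  show ?thesis
    unfolding aff_bracket_def supp
    by (auto simp: tpow_def aff_add_def aff_scale_def aff_c_def zero tr0)
qed

lemma bracket_d_tpow: "aff_bracket aff_d (tpow A m) = aff_scale (of_int m) (tpow A m)"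
  by (auto simp: aff_bracket_def aff_d_def tpow_def aff_scale_def smat_def map_matrix_def vec_eq_iff)

lemma bracket_tpow_d:
  "aff_bracket (tpow A m) aff_d = aff_scale (-1) (aff_scale (of_int m) (tpow A m))"
  by (auto simp: aff_bracket_def aff_d_def tpow_def aff_scale_def smat_def map_matrix_def
      vec_eq_iff commutator_def trace_def)

lemma bracket_c: "aff_bracket aff_c a = Aff (\<lambda>_. 0) 0 0" "aff_bracket a aff_c = Aff (\<lambda>_. 0) 0 0"
  by (auto simp: aff_bracket_def aff_c_def smat_def map_matrix_def vec_eq_iff commutator_def
      trace_def)

definition cartan :: "aff set"
  where "cartan = {aff_add (aff_scale p (tpow mat_h 0))
    (aff_add (aff_scale q aff_c) (aff_scale s aff_d)) | p q s. True}"

text \<open>Weights are functionals on \<open>cartan\<close>; their values elsewhere are irrelevant.\<close>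

definition Lambda0 :: "aff \<Rightarrow> complex"
  where "Lambda0 a = c_coeff a"

lemma Lambda0_values: "Lambda0 (tpow mat_h 0) = 0" "Lambda0 aff_c = 1" "Lambda0 aff_d = 0"
  by (simp_all add: Lambda0_def tpow_def aff_c_def aff_d_def)


section \<open>Modules\<close>

locale affine_module = vector_space smul
  for smul :: "complex \<Rightarrow> 'v::ab_group_add \<Rightarrow> 'v" +
  fixes act :: "aff \<Rightarrow> 'v \<Rightarrow> 'v"
  assumes act_linear: "a \<in> affine_sl2 \<Longrightarrow> Vector_Spaces.linear smul smul (act a)"
    and act_add: "\<lbrakk>a \<in> affine_sl2; b \<in> affine_sl2\<rbrakk> \<Longrightarrow> act (aff_add a b) u = act a u + act b u"
    and act_scale: "a \<in> affine_sl2 \<Longrightarrow> act (aff_scale s a) u = smul s (act a u)"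
    and act_bracket: "\<lbrakk>a \<in> affine_sl2; b \<in> affine_sl2\<rbrakk> \<Longrightarrow>
      act (aff_bracket a b) u = act a (act b u) - act b (act a u)"
begin

definition submodule :: "'v set \<Rightarrow> bool"
  where "submodule W \<longleftrightarrow> subspace W \<and> (\<forall>a\<in>affine_sl2. \<forall>u\<in>W. act a u \<in> W)"

end

text \<open>
  The first two conditions say that \<open>v\<close> is annihilated by \<open>e\<^sub>1 = x\<close> and \<open>e\<^sub>0 = y t\<close>.
\<close>

locale highest_weight_module = affine_module smul act
  for smul :: "complex \<Rightarrow> 'v::ab_group_add \<Rightarrow> 'v" and act :: "aff \<Rightarrow> 'v \<Rightarrow> 'v" +
  fixes wt :: "aff \<Rightarrow> complex" and v :: 'v
  assumes e1_annihilates: "act (tpow mat_x 0) v = 0"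
    and e0_annihilates: "act (tpow mat_y 1) v = 0"
    and weight: "a \<in> cartan \<Longrightarrow> act a v = smul (wt a) v"
    and nonzero: "v \<noteq> 0"
    and generates: "\<lbrakk>submodule W; v \<in> W\<rbrakk> \<Longrightarrow> W = UNIV"

text \<open>
  \<open>L(wt)\<close> with highest weight vector \<open>v\<close>; these data are determined up to isomorphism.
\<close>

locale irreducible_highest_weight_module = highest_weight_module +
  assumes irreducible: "submodule W \<Longrightarrow> W = {0} \<or> W = UNIV"


section \<open>Translation operators\<close>

definition div_power :: "(complex \<Rightarrow> 'v \<Rightarrow> 'v) \<Rightarrow> ('v \<Rightarrow> 'v) \<Rightarrow> nat \<Rightarrow> 'v \<Rightarrow> 'v"
  where "div_power smul X p u = smul (1 / fact p) ((X ^^ p) u)"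

text \<open>
  The exponential of a locally nilpotent operator: at every vector only finitely many terms are
  nonzero, and the sum ranges over those.
\<close>

definition nil_exp ::
    "(complex \<Rightarrow> 'v::ab_group_add \<Rightarrow> 'v) \<Rightarrow> ('v \<Rightarrow> 'v) \<Rightarrow> 'v \<Rightarrow> 'v"
  where "nil_exp smul X u = (\<Sum>p | (X ^^ p) u \<noteq> 0. div_power smul X p u)"

text \<open>
  A real root \<open>\<epsilon>\<alpha>\<^sub>1 + k\<delta>\<close> is encoded by the integers \<open>\<epsilon>\<close> (which is \<open>1\<close> or \<open>-1\<close>) and \<open>k\<close>.
  Below, \<open>root_vec \<epsilon> k\<close> is \<open>E\<^sub>\<alpha>\<close> and \<open>refl_op smul act \<epsilon> k\<close> is \<open>r\<^sub>\<alpha>\<close> for \<open>\<alpha> = \<epsilon>\<alpha>\<^sub>1 + k\<delta>\<close>.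
\<close>

definition root_vec :: "int \<Rightarrow> int \<Rightarrow> aff"
  where "root_vec \<epsilon> k = tpow (if \<epsilon> = 1 then mat_x else mat_y) k"

definition refl_op ::
    "(complex \<Rightarrow> 'v::ab_group_add \<Rightarrow> 'v) \<Rightarrow> (aff \<Rightarrow> 'v \<Rightarrow> 'v) \<Rightarrow> int \<Rightarrow> int \<Rightarrow> 'v \<Rightarrow> 'v"
  where "refl_op smul act \<epsilon> k =
    nil_exp smul (\<lambda>u. - act (root_vec \<epsilon> k) u) \<circ>
    nil_exp smul (act (root_vec (- \<epsilon>) (- k))) \<circ>
    nil_exp smul (\<lambda>u. - act (root_vec \<epsilon> k) u)"

text \<open>
  \<open>basic_transl smul act \<epsilon>\<close> is \<open>T\<^sub>\<gamma>\<close> for \<open>\<gamma> = \<epsilon>\<alpha>\<^sub>1\<close>, \<open>\<epsilon> = 1\<close> or \<open>-1\<close>, and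
  \<open>transl_op smul act b\<close> is \<open>T\<^sub>\<beta>\<close> for \<open>\<beta> = b\<alpha>\<^sub>1\<close>, \<open>b\<close> any integer.
\<close>

definition basic_transl ::
    "(complex \<Rightarrow> 'v::ab_group_add \<Rightarrow> 'v) \<Rightarrow> (aff \<Rightarrow> 'v \<Rightarrow> 'v) \<Rightarrow> int \<Rightarrow> 'v \<Rightarrow> 'v"
  where "basic_transl smul act \<epsilon> = refl_op smul act (- \<epsilon>) 1 \<circ> refl_op smul act \<epsilon> 0"

definition transl_op ::
    "(complex \<Rightarrow> 'v::ab_group_add \<Rightarrow> 'v) \<Rightarrow> (aff \<Rightarrow> 'v \<Rightarrow> 'v) \<Rightarrow> int \<Rightarrow> 'v \<Rightarrow> 'v"
  where "transl_op smul act b =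
    (if b \<ge> 0 then basic_transl smul act 1 ^^ nat b
     else basic_transl smul act (-1) ^^ nat (- b))"


section \<open>Partitions and the vectors attached to them\<close>

text \<open>A partition is indexed from \<open>0\<close>: \<open>lam i\<close> is \<open>\<lambda>\<^bsub>i+1\<^esub>\<close>.\<close>

definition is_partition :: "(nat \<Rightarrow> nat) \<Rightarrow> bool"
  where "is_partition lam \<longleftrightarrow> antimono lam \<and> finite {i. lam i \<noteq> 0}"

definition part_size :: "(nat \<Rightarrow> nat) \<Rightarrow> nat"
  where "part_size lam = (\<Sum>i | lam i \<noteq> 0. lam i)"

definition part_supp :: "(nat \<Rightarrow> nat) \<Rightarrow> nat"
  where "part_supp lam = card {i. lam i \<noteq> 0}"

type_synonym triple = "nat \<times> nat \<times> (nat \<Rightarrow> nat)"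

definition PP :: "nat \<Rightarrow> triple set"
  where "PP n = {(n, k, lam) | k lam.
    k \<le> n \<and> is_partition lam \<and> lam 0 \<le> k \<and> part_supp lam \<le> n - k}"

definition PP_stab :: "nat \<Rightarrow> triple set"
  where "PP_stab n = {(n, k, lam) | k lam. (n, k, lam) \<in> PP n \<and> part_size lam \<le> min (n - k) k}"

fun mult :: "triple \<Rightarrow> nat \<Rightarrow> nat"
  where "mult (n, k, lam) j = (if j = 0 then n - k - part_supp lam else card {i. lam i = j})"

text \<open>The sign is an integer power, since its exponent may be negative.\<close>

fun zcoeff :: "triple \<Rightarrow> complex"
  where "zcoeff (n, k, lam) =
    (-1) powi (int (n div 4) - int ((n - k) div 2)) / (\<Prod>j=0..k. fact (mult (n, k, lam) j))"

definition wvec ::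
    "(complex \<Rightarrow> 'v::ab_group_add \<Rightarrow> 'v) \<Rightarrow> (aff \<Rightarrow> 'v \<Rightarrow> 'v) \<Rightarrow> 'v \<Rightarrow> nat \<Rightarrow> 'v"
  where "wvec smul act v n = div_power smul (act (tpow mat_x (- int (n div 2)))) (n div 2) v"

fun cvec ::
    "(complex \<Rightarrow> 'v::ab_group_add \<Rightarrow> 'v) \<Rightarrow> (aff \<Rightarrow> 'v \<Rightarrow> 'v) \<Rightarrow> 'v \<Rightarrow> triple \<Rightarrow> 'v"
  where "cvec smul act v (n, k, lam) =
    smul (zcoeff (n, k, lam))
      (foldr (\<lambda>i. act (tpow mat_y (int k - int (lam i)))) [0..<n - k] (wvec smul act v n))"

end

theory Submission
  imports Defs
begin

text \<open>
  Write \<open>x\<^sub>k\<close>, \<open>y\<^sub>k\<close>, \<open>h\<^sub>k\<close> for the actions of \<open>x t\<^sup>k\<close>, \<open>y t\<^sup>k\<close>, \<open>h t\<^sup>k\<close>. A linear operator on the irreducible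
  module is determined by its value at the vacuum \<open>v\<close> and by how it commutes past all \<open>x\<^sub>k\<close> and
  \<open>y\<^sub>k\<close>. Expanding \<open>e\<^sup>A B e\<^sup>-\<^sup>A\<close> shows that reflections permute the \<open>x\<^sub>k\<close> and \<open>y\<^sub>k\<close> up to sign; this
  gives \<open>T x\<^sub>k = x\<^bsub>k-2\<^esub> T\<close> and \<open>T y\<^sub>k = y\<^bsub>k+2\<^esub> T\<close> for \<open>T = T\<^bsub>\<alpha>\<^sub>1\<^esub>\<close>, local nilpotency of all \<open>x\<^sub>k\<close>, \<open>y\<^sub>k\<close>
  (starting from \<open>y\<^sub>0 v = 0 = x\<^bsub>-1\<^esub>\<^sup>2 v\<close>, which is irreducibility), and \<open>T\<^bsub>-\<alpha>\<^sub>1\<^esub> = T\<^sup>-\<^sup>1\<close>. By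
  \<open>sl\<^sub>2\<close>-theory \<open>w\<^bsub>2N\<^esub>\<close> is the image of \<open>v\<close> under the reflection in \<open>N\<delta> - \<alpha>\<^sub>1\<close>, and that reflection
  equals \<open>(-1)\<^bsup>[N/2]\<^esup> T\<^sup>N r\<close> with \<open>r = r\<^bsub>\<alpha>\<^sub>1\<^esub>\<close>.
\<close>

section \<open>Exponentials of locally nilpotent operators\<close>

locale complex_space = vector_space smul
  for smul :: "complex \<Rightarrow> 'v::ab_group_add \<Rightarrow> 'v"
begin

sublocale lin: vector_space_pair smul smul
  by unfold_locales

abbreviation lin :: "('v \<Rightarrow> 'v) \<Rightarrow> bool"
  where "lin \<equiv> Vector_Spaces.linear smul smul"

definition nilp :: "('v \<Rightarrow> 'v) \<Rightarrow> bool"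
  where "nilp A \<longleftrightarrow> (\<forall>u. \<exists>p. (A ^^ p) u = 0)"

lemma lin_neg: "lin A \<Longrightarrow> lin (\<lambda>u. - A u)"
  by (rule lin.linear_compose_neg)

lemma lin_comp: "lin A \<Longrightarrow> lin B \<Longrightarrow> lin (\<lambda>u. A (B u))"
  using Vector_Spaces.linear_compose[of smul smul B smul A] by (simp add: o_def)

lemma linI:
  "(\<And>u w. A (u + w) = A u + A w) \<Longrightarrow> (\<And>s u. A (smul s u) = smul s (A u)) \<Longrightarrow> lin A"
  by unfold_locales

lemma lin_funpow: "lin A \<Longrightarrow> lin (A ^^ p)"
  by (induction p) (auto intro!: linI simp: lin.linear_add lin.linear_scale)

lemma funpow_zero_mono:
  assumes "lin A" "(A ^^ p) u = 0" "p \<le> q"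
  shows "(A ^^ q) u = 0"
proof -
  have "(A ^^ q) u = (A ^^ (q - p)) ((A ^^ p) u)"
    using assms(3) by (simp flip: funpow_add[THEN fun_cong, unfolded o_apply])
  then show ?thesis
    using lin_funpow[OF assms(1)] assms(2) by (simp add: lin.linear_0)
qed

lemma funpow_neg: "lin A \<Longrightarrow> ((\<lambda>u. - A u) ^^ p) u = smul ((-1) ^ p) ((A ^^ p) u)"
  by (induction p) (auto simp: lin.linear_scale)

lemma nilp_neg: "lin A \<Longrightarrow> nilp A \<Longrightarrow> nilp (\<lambda>u. - A u)"
  unfolding nilp_def by (metis funpow_neg scale_zero_right)

lemma nilpE:
  assumes "lin A" "nilp A"
  obtains M where "\<And>p. M \<le> p \<Longrightarrow> (A ^^ p) u = 0"
  using assms funpow_zero_mono unfolding nilp_def by metis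

lemma lin_div_power: "lin A \<Longrightarrow> lin (div_power smul A p)"
  unfolding div_power_def
  by (rule lin.linear_compose_scale_right, rule lin_funpow)

text \<open>Terms beyond the vanishing point add nothing, so expansions at several vectors can share
  one range.\<close>

lemma nil_exp_eq:
  assumes "lin A" "\<And>p. M \<le> p \<Longrightarrow> (A ^^ p) u = 0"
  shows "nil_exp smul A u = (\<Sum>p<M. div_power smul A p u)"
  unfolding nil_exp_def
  by (rule sum.mono_neutral_left) (use assms(2) in \<open>auto simp: div_power_def not_less[symmetric]\<close>)

lemma nil_exp_fixed:
  assumes "lin A" "A u = 0"
  shows "nil_exp smul A u = u"
proof -
  have "(A ^^ p) u = 0" if "1 \<le> p" for p
    using funpow_zero_mono[OF assms(1) _ that] assms(2) by simp
  from nil_exp_eq[OF assms(1) this] show ?thesis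
    by (simp add: div_power_def)
qed

lemma lin_nil_exp:
  assumes A: "lin A" "nilp A"
  shows "lin (nil_exp smul A)"
proof (rule linI)
  fix u w s
  obtain M1 where M1: "\<And>p. M1 \<le> p \<Longrightarrow> (A ^^ p) u = 0"
    using nilpE[OF A] by blast
  obtain M2 where M2: "\<And>p. M2 \<le> p \<Longrightarrow> (A ^^ p) w = 0"
    using nilpE[OF A] by blast
  define M where "M = max M1 M2"
  have u: "(A ^^ p) u = 0" and w: "(A ^^ p) w = 0" if "M \<le> p" for p
    using that M1 M2 by (auto simp: M_def)
  note P = lin_funpow[OF A(1)] and D = lin_div_power[OF A(1)]
  show "nil_exp smul A (u + w) = nil_exp smul A u + nil_exp smul A w"
    using u w by (simp add: nil_exp_eq[OF A(1), of M] P lin.linear_add sum.distrib lin.linear_add[OF D])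
  show "nil_exp smul A (smul s u) = smul s (nil_exp smul A u)"
    using u by (simp add: nil_exp_eq[OF A(1), of M] P lin.linear_scale lin.linear_scale[OF D] scale_sum_right)
qed

lemma nil_exp_intertwine:
  assumes "lin A" "nilp A" "lin A'" "lin S" and S: "\<And>u. S (A u) = A' (S u)"
  shows "S (nil_exp smul A u) = nil_exp smul A' (S u)"
proof -
  have P: "S ((A ^^ p) u) = (A' ^^ p) (S u)" for p
    by (induction p) (simp_all add: S)
  obtain M where M: "\<And>p. M \<le> p \<Longrightarrow> (A ^^ p) u = 0"
    using nilpE[OF assms(1,2)] by blast
  then have M': "\<And>p. M \<le> p \<Longrightarrow> (A' ^^ p) (S u) = 0"
    using P lin.linear_0[OF assms(4)] by metis
  show ?thesis
    using assms(1,3,4) M M'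
    by (simp add: nil_exp_eq[of _ M] lin.linear_sum lin.linear_scale div_power_def P)
qed

section \<open>Nilpotency at a single vector\<close>

abbreviation nilp_at :: "('v \<Rightarrow> 'v) \<Rightarrow> 'v \<Rightarrow> bool"
  where "nilp_at A u \<equiv> \<exists>p. (A ^^ p) u = 0"

lemma subspace_nilp_at:
  assumes "lin A"
  shows "subspace {u. nilp_at A u}"
proof (rule subspaceI; clarsimp)
  show "nilp_at A 0"
    by (rule exI[of _ 0]) simp
next
  fix u w p q
  assume "(A ^^ p) u = 0" "(A ^^ q) w = 0"
  then have "(A ^^ (p + q)) (u + w) = 0"
    using funpow_zero_mono[OF assms, where p = p and q = "p + q"]
      funpow_zero_mono[OF assms, where p = q and q = "p + q"]
    by (simp add: lin.linear_add[OF lin_funpow[OF assms]])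
  then show "nilp_at A (u + w)" by blast
next
  fix s u p
  assume "(A ^^ p) u = 0"
  then show "nilp_at A (smul s u)"
    by (intro exI[of _ p]) (simp add: lin.linear_scale[OF lin_funpow[OF assms]])
qed

text \<open>The sign is there because reflections exchange the \<open>X\<close> and \<open>Y\<close>
  modes up to sign.\<close>

lemma nilp_at_intertwine:
  assumes "lin A" "lin B" "lin S" and S: "\<And>u. S (A u) = - B (S u)" and "nilp_at A u"
  shows "nilp_at B (S u)"
proof -
  from assms(5) obtain p where p: "(A ^^ p) u = 0" by blast
  have "S ((A ^^ p) u) = smul ((-1) ^ p) ((B ^^ p) (S u))" for p
    by (induction p) (simp_all add: S lin.linear_scale[OF assms(2)])
  from this[of p] p show ?thesis
    using lin.linear_0[OF assms(3)] by (intro exI[of _ p]) simp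
qed

text \<open>Induction on the exponent killing \<open>u\<close>: it is smaller for
  \<open>A u\<close>, so \<open>B (A u)\<close> and \<open>C u\<close> are both killed by powers of
  \<open>A\<close>, and their sum is \<open>A (B u)\<close>.\<close>

lemma nilp_orbit_step:
  assumes "lin A" "lin B" and AB: "\<And>u. A (B u) = B (A u) + C u"
    and C: "\<And>u. \<exists>p. (A ^^ p) u = 0 \<Longrightarrow> \<exists>p. (A ^^ p) (C u) = 0"
    and "\<exists>p. (A ^^ p) u = 0"
  shows "\<exists>p. (A ^^ p) (B u) = 0"
proof -
  from assms(5) obtain p where "(A ^^ p) u = 0" by blast
  then show ?thesis
  proof (induction p arbitrary: u)
    case 0
    then show ?case
      using lin.linear_0[OF assms(2)] by (intro exI[of _ 0]) simp
  next
    case (Suc p)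
    then have "(A ^^ p) (A u) = 0"
      by (simp add: funpow_swap1)
    from Suc.IH[OF this] obtain q where q: "(A ^^ q) (B (A u)) = 0" by blast
    from C[of u] Suc.prems obtain s where s: "(A ^^ s) (C u) = 0" by blast
    have "(A ^^ (q + s)) (A (B u)) = 0"
      using funpow_zero_mono[OF assms(1) q, of "q + s"] funpow_zero_mono[OF assms(1) s, of "q + s"]
      by (simp add: AB lin.linear_add[OF lin_funpow[OF assms(1)]])
    then have "(A ^^ Suc (q + s)) (B u) = 0"
      by (simp add: funpow_swap1)
    then show ?case by blast
  qed
qed

text \<open>Leibniz rule with \<open>C = [A, B]\<close>, \<open>D = [A, C]\<close> and
  \<open>[A, D] = 0\<close>; powers start at two so that all three exponents are natural
  numbers.\<close>

lemma funpow_ad: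
  assumes "lin A" "lin B" "lin C" "lin D"
    and AB: "\<And>u. A (B u) = B (A u) + C u" and AC: "\<And>u. A (C u) = C (A u) + D u"
    and AD: "\<And>u. A (D u) = D (A u)"
  shows "(A ^^ Suc (Suc p)) (B u) = B ((A ^^ Suc (Suc p)) u)
    + smul (of_nat (Suc (Suc p))) (C ((A ^^ Suc p) u))
    + smul (of_nat (Suc (Suc p)) * of_nat (Suc p) / 2) (D ((A ^^ p) u))"
proof (induction p)
  case 0
  have "A (A (B u)) = B (A (A u)) + (C (A u) + C (A u)) + D u"
    using assms(1) by (simp add: AB AC lin.linear_add)
  moreover have "smul 2 (C (A u)) = C (A u) + C (A u)"
    using scale_left_distrib[of 1 1] by simp
  ultimately show ?case by simp
next
  case (Suc p)
  let ?q = "Suc (Suc p)"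
  have "(A ^^ Suc ?q) (B u) = A ((A ^^ ?q) (B u))"
    by simp
  also have "\<dots> = B ((A ^^ Suc ?q) u) + (C ((A ^^ ?q) u) + smul (of_nat ?q) (C ((A ^^ ?q) u)))
      + (smul (of_nat ?q) (D ((A ^^ Suc p) u))
        + smul (of_nat ?q * of_nat (Suc p) / 2) (D ((A ^^ Suc p) u)))"
    unfolding Suc using assms(1)
    by (simp add: AB AC AD lin.linear_add lin.linear_scale scale_right_distrib del: of_nat_Suc)
  also have "C ((A ^^ ?q) u) + smul (of_nat ?q) (C ((A ^^ ?q) u))
      = smul (of_nat (Suc ?q)) (C ((A ^^ ?q) u))"
    using scale_left_distrib[of 1 "of_nat ?q" "C ((A ^^ ?q) u)"] by (simp del: funpow.simps)
  also have "smul (of_nat ?q) (D ((A ^^ Suc p) u))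
      + smul (of_nat ?q * of_nat (Suc p) / 2) (D ((A ^^ Suc p) u))
      = smul (of_nat (Suc ?q) * of_nat ?q / 2) (D ((A ^^ Suc p) u))"
    unfolding scale_left_distrib[symmetric]
    by (rule arg_cong[of _ _ "\<lambda>s. smul s _"]) (simp add: field_simps)
  finally show ?case .
qed

text \<open>The series for \<open>ad A\<close> stops after the quadratic term:
  \<open>e^A B e^(-A) = B + C + D / 2\<close>, with \<open>e^(-A)\<close> moved to the other
  side.\<close>

lemma nil_exp_ad:
  assumes "lin A" "nilp A" "lin B" "lin C" "lin D"
    and AB: "\<And>u. A (B u) = B (A u) + C u" and AC: "\<And>u. A (C u) = C (A u) + D u"
    and AD: "\<And>u. A (D u) = D (A u)"
  shows "nil_exp smul A (B u) =
    B (nil_exp smul A u) + C (nil_exp smul A u) + smul (1 / 2) (D (nil_exp smul A u))"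
proof -
  let ?D = "\<lambda>p u. div_power smul A p u"
  obtain M where M: "\<And>p. M \<le> p \<Longrightarrow> (A ^^ p) u = 0"
    using nilpE[OF assms(1,2)] by blast
  obtain M' where M': "\<And>p. M' \<le> p \<Longrightarrow> (A ^^ p) (B u) = 0"
    using nilpE[OF assms(1,2)] by blast
  define K where "K = max M M'"
  \<comment> \<open>\<open>B\<close>, \<open>C\<close> and \<open>D\<close> meet the powers
    \<open>p + 2\<close>, \<open>p + 1\<close> and \<open>p\<close> of \<open>A\<close>, hence the
    three ranges.\<close>
  have K: "nil_exp smul A u = (\<Sum>p<K. ?D p u)"
    "nil_exp smul A u = (\<Sum>p<Suc K. ?D p u)"
    "nil_exp smul A u = (\<Sum>p<Suc (Suc K). ?D p u)"
    "nil_exp smul A (B u) = (\<Sum>p<Suc (Suc K). ?D p (B u))"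
    by (rule nil_exp_eq[OF assms(1)]; use M M' in \<open>simp add: K_def\<close>)+
  have step: "?D (Suc (Suc p)) (B u) =
      B (?D (Suc (Suc p)) u) + C (?D (Suc p) u) + smul (1 / 2) (D (?D p u))" for p
  proof -
    let ?q = "Suc (Suc p)"
    have 1: "1 / fact ?q * of_nat ?q = (1 / fact (Suc p) :: complex)"
      by (simp add: divide_simps del: of_nat_Suc)
    have 2: "1 / fact ?q * (of_nat ?q * of_nat (Suc p) / 2) = (1 / 2 * (1 / fact p) :: complex)"
      by (simp add: divide_simps del: of_nat_Suc)
    show ?thesis
      unfolding div_power_def funpow_ad[OF assms(1,3-5) AB AC AD, of p u]
      using assms(3-5) unfolding scale_right_distrib scale_scale 1 2
      by (simp add: lin.linear_scale del: fact_Suc of_nat_Suc)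
  qed
  have 0: "?D 0 (B u) = B (?D 0 u)" and 1: "?D (Suc 0) (B u) = B (?D (Suc 0) u) + C (?D 0 u)"
    by (simp_all add: div_power_def AB)
  have "nil_exp smul A (B u) =
    ?D 0 (B u) + ?D (Suc 0) (B u) + (\<Sum>p<K. ?D (Suc (Suc p)) (B u))"
    unfolding K(4) sum.lessThan_Suc_shift by (simp add: add.assoc)
  also have "\<dots> = (B (?D 0 u) + B (?D (Suc 0) u) + (\<Sum>p<K. B (?D (Suc (Suc p)) u)))
      + (C (?D 0 u) + (\<Sum>p<K. C (?D (Suc p) u))) + (\<Sum>p<K. smul (1 / 2) (D (?D p u)))"
    unfolding step 0 1 sum.distrib by (simp add: algebra_simps)
  also have "B (?D 0 u) + B (?D (Suc 0) u) + (\<Sum>p<K. B (?D (Suc (Suc p)) u)) = B (nil_exp smul A u)"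
    unfolding K(3) lin.linear_sum[OF assms(3)] sum.lessThan_Suc_shift
    by (simp add: add.assoc lin.linear_add[OF assms(3)] lin.linear_sum[OF assms(3)])
  also have "C (?D 0 u) + (\<Sum>p<K. C (?D (Suc p) u)) = C (nil_exp smul A u)"
    unfolding K(2) lin.linear_sum[OF assms(4)] sum.lessThan_Suc_shift
    by (simp add: lin.linear_add[OF assms(4)] lin.linear_sum[OF assms(4)])
  also have "(\<Sum>p<K. smul (1 / 2) (D (?D p u))) = smul (1 / 2) (D (nil_exp smul A u))"
    unfolding K(1) lin.linear_sum[OF assms(5)] scale_sum_right ..
  finally show ?thesis .
qed

text \<open>Cauchy product: total degree \<open>k\<close> carries an alternating binomial sum, which
  is zero unless \<open>k = 0\<close>.\<close>

lemma nil_exp_neg_inverse: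
  assumes "lin A" "nilp A"
  shows "nil_exp smul (\<lambda>u. - A u) (nil_exp smul A u) = u"
proof -
  note N = lin_neg[OF assms(1)] nilp_neg[OF assms]
  obtain M where M: "\<And>p. M \<le> p \<Longrightarrow> (A ^^ p) u = 0"
    using nilpE[OF assms] by blast
  define g where "g p q = smul ((-1) ^ p / (fact p * fact q)) ((A ^^ (p + q)) u)" for p q
  have "nil_exp smul (\<lambda>u. - A u) (nil_exp smul A u) =
      (\<Sum>q<Suc M. nil_exp smul (\<lambda>u. - A u) (div_power smul A q u))"
    using M by (subst nil_exp_eq[OF assms(1), of "Suc M"])
      (simp_all add: lin.linear_sum[OF lin_nil_exp[OF N]] lin.linear_add[OF lin_nil_exp[OF N]])
  also have "\<dots> = (\<Sum>q<Suc M. \<Sum>p<Suc M. g p q)"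
  proof (rule sum.cong[OF refl])
    fix q
    have z: "(A ^^ p) (div_power smul A q u) = smul (1 / fact q) ((A ^^ (p + q)) u)" for p
      by (simp add: div_power_def lin.linear_scale[OF lin_funpow[OF assms(1)]] funpow_add)
    have "((\<lambda>u. - A u) ^^ p) (div_power smul A q u) = 0" if "Suc M \<le> p" for p
      using that M by (simp add: funpow_neg[OF assms(1)] z)
    then show "nil_exp smul (\<lambda>u. - A u) (div_power smul A q u) = (\<Sum>p<Suc M. g p q)"
      by (subst nil_exp_eq[OF N(1), of "Suc M"])
        (auto simp: div_power_def[of _ "\<lambda>u. - A u"] funpow_neg[OF assms(1)] z g_def intro!: sum.cong)
  qed
  also have "\<dots> = (\<Sum>(p, q)\<in>{..M} \<times> {..M}. g p q)"
    by (subst sum.swap) (simp add: sum.cartesian_product lessThan_Suc_atMost)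
  \<comment> \<open>Outside the triangle the power of \<open>A\<close> exceeds \<open>M\<close> and
    kills \<open>u\<close>.\<close>
  also have "\<dots> = (\<Sum>(p, q)\<in>{(p, q). p + q \<le> M}. g p q)"
  proof (rule sum.mono_neutral_right)
    have "g p q = 0" if "\<not> p + q \<le> M" for p q
      using M[of "p + q"] that by (simp add: g_def)
    then show "\<forall>i\<in>{..M} \<times> {..M} - {(p, q). p + q \<le> M}. (case i of (p, q) \<Rightarrow> g p q) = 0"
      by auto
  qed auto
  also have "\<dots> = (\<Sum>k\<le>M. \<Sum>p\<le>k. g p (k - p))"
    by (rule sum.triangle_reindex_eq)
  also have "\<dots> = (\<Sum>k\<le>M. if k = 0 then u else 0)"
  proof (rule sum.cong[OF refl])
    fix k
    have "(\<Sum>p\<le>k. g p (k - p)) = (\<Sum>p\<le>k. smul (1 / fact k * ((-1) ^ p * of_nat (k choose p))) ((A ^^ k) u))"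
      by (rule sum.cong) (auto simp: g_def binomial_fact)
    also have "\<dots> = smul (1 / fact k * (\<Sum>p\<le>k. (-1) ^ p * of_nat (k choose p))) ((A ^^ k) u)"
      by (simp add: scale_sum_left sum_distrib_left)
    also have "\<dots> = (if k = 0 then u else 0)"
      using choose_alternating_sum[of k, where 'a=complex] by (cases k) auto
    finally show "(\<Sum>p\<le>k. g p (k - p)) = (if k = 0 then u else 0)" .
  qed
  also have "\<dots> = u"
    by simp
  finally show ?thesis .
qed

text \<open>
  Since \<open>e\<^sup>E\<close> sends \<open>F\<^sup>(\<^sup>N\<^sup>) v\<close> to \<open>e\<^sup>F v\<close>, the operator \<open>e\<^bsup>-E\<^esup>\<close> undoes this.
\<close>

lemma reflection_extremal:
  assumes E: "lin E" "nilp E" and F: "lin F" "nilp F" and "E v = 0"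
    and EF: "\<And>p. E ((F ^^ Suc p) v) = smul (of_nat (Suc p) * (of_nat N - of_nat p)) ((F ^^ p) v)"
  shows "nil_exp smul (\<lambda>u. - E u) (nil_exp smul F (nil_exp smul (\<lambda>u. - E u) v)) = div_power smul F N v"
proof (cases "v = 0")
  case True
  then show ?thesis
    using lin_nil_exp[OF lin_neg[OF E(1)] nilp_neg[OF E]] lin_nil_exp[OF F]
    by (simp add: lin.linear_0 lin.linear_0[OF lin_div_power[OF F(1)]])
next
  case False
  let ?D = "\<lambda>p. div_power smul F p v"
  \<comment> \<open>If \<open>F^m v\<close> is the last nonzero power, then
    \<open>0 = E (F^(m+1) v) = (m+1) (N-m) F^m v\<close> forces \<open>m = N\<close>.\<close>
  have FN: "(F ^^ Suc N) v = 0"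
  proof -
    obtain M0 where M0: "\<And>p. M0 \<le> p \<Longrightarrow> (F ^^ p) v = 0"
      using nilpE[OF F] by blast
    define M where "M = (LEAST p. (F ^^ p) v = 0)"
    have M: "(F ^^ M) v = 0"
      unfolding M_def using M0[OF order_refl] by (rule LeastI)
    with False have "M \<noteq> 0" by (cases M) auto
    then obtain m where m: "M = Suc m" by (cases M) auto
    then have "(F ^^ m) v \<noteq> 0"
      using not_less_Least[of m "\<lambda>p. (F ^^ p) v = 0"] by (auto simp: M_def)
    with EF[of m] M m lin.linear_0[OF E(1)]
    have "of_nat (Suc m) * (of_nat N - of_nat m) = (0 :: complex)"
      by (metis scale_eq_0_iff)
    then have "m = N"
      by (simp del: of_nat_Suc)
    with M m show ?thesis by simp
  qed
  have F0: "(F ^^ p) v = 0" if "Suc N \<le> p" for p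
    using funpow_zero_mono[OF F(1) FN that] .
  have ED: "E (?D (Suc p)) = smul (of_nat N - of_nat p) (?D p)" for p
  proof -
    have "1 / fact (Suc p) * (of_nat (Suc p) * (of_nat N - of_nat p)) =
        (of_nat N - of_nat p) * (1 / fact p :: complex)"
      by (simp add: divide_simps del: of_nat_Suc)
    then show ?thesis
      unfolding div_power_def lin.linear_scale[OF E(1)] EF by simp
  qed
  \<comment> \<open>So \<open>E^j / j!\<close> takes \<open>?D N\<close> to
    \<open>?D (N - j)\<close>, and \<open>e^E\<close> applied to \<open>?D N\<close> sums the whole
    string.\<close>
  have EN: "(E ^^ j) (?D N) = smul (fact j) (?D (N - j))" if "j \<le> N" for j
    using that
  proof (induction j)
    case (Suc j)
    then have "N - j = Suc (N - Suc j)" by simp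
    then have "E (?D (N - j)) = smul (of_nat (Suc j)) (?D (N - Suc j))"
      using ED[of "N - Suc j"] Suc.prems by (simp add: of_nat_diff)
    then show ?case
      using Suc E(1) by (simp add: lin.linear_scale algebra_simps del: of_nat_Suc)
  qed simp
  have D0: "E (?D 0) = 0"
    using assms(5) by (simp add: div_power_def)
  have "(E ^^ Suc N) (?D N) = 0"
    using EN[of N] D0 E(1) by (simp add: lin.linear_scale)
  then have E0: "(E ^^ p) (?D N) = 0" if "Suc N \<le> p" for p
    using funpow_zero_mono[OF E(1) _ that] by blast
  have "nil_exp smul E (?D N) = (\<Sum>j<Suc N. div_power smul E j (?D N))"
    using nil_exp_eq[OF E(1) E0] .
  also have "\<dots> = (\<Sum>j<Suc N. ?D (N - j))"
    by (rule sum.cong) (auto simp: div_power_def[of _ E] EN)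
  also have "\<dots> = (\<Sum>j<Suc N. ?D j)"
    using sum.nat_diff_reindex[of ?D "Suc N"] by simp
  also have "\<dots> = nil_exp smul F v"
    using nil_exp_eq[OF F(1) F0] by simp
  finally have "nil_exp smul F v = nil_exp smul E (?D N)" ..
  moreover have "nil_exp smul (\<lambda>u. - E u) v = v"
    using nil_exp_fixed[OF lin_neg[OF E(1)]] assms(5) by simp
  ultimately show ?thesis
    using nil_exp_neg_inverse[OF E] by simp
qed

end

section \<open>Conjugation by reflections\<close>

text \<open>
  The operators by which \<open>x t\<^sup>k\<close>, \<open>y t\<^sup>k\<close>, \<open>h t\<^sup>k\<close> act when \<open>c\<close> acts as the identity.
\<close>

locale level_one = complex_space smul
  for smul :: "complex \<Rightarrow> 'v::ab_group_add \<Rightarrow> 'v" +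
  fixes X Y H :: "int \<Rightarrow> 'v \<Rightarrow> 'v"
  assumes lin_X: "lin (X k)" and lin_Y: "lin (Y k)" and lin_H: "lin (H k)"
    and XX: "X j (X k u) = X k (X j u)"
    and YY: "Y j (Y k u) = Y k (Y j u)"
    and HX: "H j (X k u) = X k (H j u) + smul 2 (X (j + k) u)"
    and HY: "H j (Y k u) = Y k (H j u) - smul 2 (Y (j + k) u)"
    and XY: "X j (Y k u) = Y k (X j u) + H (j + k) u + smul (if j = - k then of_int j else 0) u"
begin

text \<open>The relations survive exchanging \<open>x\<close> with \<open>y\<close> and negating
  \<open>h\<close>, so each result has a twin; the twin of \<open>refl k\<close> is the reflection
  in \<open>k\<delta> - \<alpha>\<^sub>1\<close>.\<close>

lemma swap: "level_one smul Y X (\<lambda>k u. - H k u)"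
proof (intro level_one.intro complex_space_axioms level_one_axioms.intro)
  fix j k u
  show "Y j (X k u) = X k (Y j u) + - H (j + k) u + smul (if j = - k then of_int j else 0) u"
    using XY[of k j u] by (cases "j = - k") (simp_all add: add.commute[of k j] algebra_simps)
  show "- H j (Y k u) = Y k (- H j u) + smul 2 (Y (j + k) u)"
    unfolding HY by (simp add: lin.linear_neg[OF lin_Y])
  show "- H j (X k u) = X k (- H j u) - smul 2 (X (j + k) u)"
    unfolding HX by (simp add: lin.linear_neg[OF lin_X])
qed (rule XX YY lin_X lin_Y lin_neg[OF lin_H])+

lemma XH: "X k (H j u) = H j (X k u) + smul (- 2) (X (j + k) u)"
  by (simp add: HX)

definition central :: "int \<Rightarrow> int \<Rightarrow> 'v \<Rightarrow> 'v"
  where "central j k u = smul (if j = - k then of_int k else 0) u"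

lemma XY': "X k (Y j u) = Y j (X k u) + (H (j + k) u + central j k u)"
  unfolding central_def by (subst XY) (auto simp: add.commute)

lemma lin_central: "lin (central j k)"
  unfolding central_def by (rule linI) (simp_all add: scale_right_distrib)

text \<open>Brackets with \<open>X k\<close> lead from \<open>Y\<close> to \<open>H\<close> and
  scalars, from \<open>H\<close> to \<open>X\<close>, and from \<open>X\<close> to zero; nilpotency
  is carried over in the reverse order.\<close>

lemma nilp_at_X:
  assumes "nilp_at (X k) u"
  shows "nilp_at (X k) (X j u)" and "nilp_at (X k) (Y j u)"
proof -
  have X: "nilp_at (X k) (X j u)" if "nilp_at (X k) u" for j u
  proof (rule nilp_orbit_step[OF lin_X lin_X, where C = "\<lambda>_. 0"])
    show "X k (X j u) = X j (X k u) + 0" for u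
      by (simp add: XX[of k j])
    show "nilp_at (X k) 0"
      by (intro exI[of _ 0]) simp
  qed (rule that)
  note scale = subspace_scale[OF subspace_nilp_at[OF lin_X], simplified]
  note add = subspace_add[OF subspace_nilp_at[OF lin_X], simplified]
  have H: "nilp_at (X k) (H j u)" if "nilp_at (X k) u" for j u
  proof (rule nilp_orbit_step[OF lin_X lin_H, where C = "\<lambda>u. smul (-2) (X (j + k) u)"])
    show "X k (H j u) = H j (X k u) + smul (-2) (X (j + k) u)" for u
      by (rule XH)
    show "nilp_at (X k) (smul (- 2) (X (j + k) u))" if "nilp_at (X k) u" for u
      by (rule scale[OF X[OF that]])
  qed (rule that)
  show "nilp_at (X k) (X j u)"
    using X assms .
  have C: "nilp_at (X k) (H (j + k) u + central j k u)" if "nilp_at (X k) u" for u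
    unfolding central_def by (intro add H scale that)
  show "nilp_at (X k) (Y j u)"
    by (rule nilp_orbit_step[OF lin_X lin_Y XY' C assms])
qed

section \<open>Conjugation of the modes by exponentials\<close>

lemma X_scale: "X k (smul s (X j u)) = smul s (X j (X k u))"
  by (simp only: lin.linear_scale[OF lin_X] XX[of k j])

lemma X_ad_Y:
  "X k (H (j + k) u + central j k u) = (H (j + k) (X k u) + central j k (X k u)) + smul (- 2) (X (j + 2 * k) u)"
proof -
  have "X k (central j k u) = central j k (X k u)"
    unfolding central_def by (rule lin.linear_scale[OF lin_X])
  moreover have "X k (H (j + k) u) = H (j + k) (X k u) + smul (- 2) (X (j + 2 * k) u)"
    using XH[of k "j + k" u] by (simp add: add.assoc[of j k k])
  ultimately show ?thesis
    unfolding lin.linear_add[OF lin_X] by (simp add: add_ac)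
qed

text \<open>The bracket with \<open>X k\<close> kills \<open>X j\<close> at once, \<open>H j\<close>
  after two steps and \<open>Y j\<close> after three, which gives one, two and three kinds of
  terms.\<close>

lemma exp_X:
  assumes "nilp (X k)"
  defines "e \<equiv> nil_exp smul (X k)"
  shows "e (X j u) = X j (e u)"
    and "e (H j u) = H j (e u) - smul 2 (X (j + k) (e u))"
    and "e (Y j u) = Y j (e u) + H (j + k) (e u) + central j k (e u) - X (j + 2 * k) (e u)"
proof -
  note ad = nil_exp_ad[where A = "X k", OF lin_X assms(1)]
  have scl: "lin (\<lambda>u. smul s (X j u))" for s j
    by (rule lin.linear_compose_scale_right[OF lin_X])
  show "e (X j u) = X j (e u)"
    unfolding e_def using nil_exp_intertwine[of "X k" "X k" "X j"] assms(1) lin_X XX[of j k] by simp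
  have 1: "X k (smul (- 2) (X (j + k) u)) = smul (- 2) (X (j + k) (X k u)) + 0" for u
    by (simp only: X_scale add_0_right)
  show "e (H j u) = H j (e u) - smul 2 (X (j + k) (e u))"
    using ad[of "H j" "\<lambda>u. smul (- 2) (X (j + k) u)" "\<lambda>_. 0" u,
        OF lin_H scl lin.linear_zero XH 1 lin.linear_0[OF lin_X]]
    unfolding e_def by simp
  have 2: "lin (\<lambda>u. H (j + k) u + central j k u)"
    by (rule lin.linear_compose_add[OF lin_H lin_central])
  show "e (Y j u) = Y j (e u) + H (j + k) (e u) + central j k (e u) - X (j + 2 * k) (e u)"
    using ad[of "Y j" "\<lambda>u. H (j + k) u + central j k u" "\<lambda>u. smul (- 2) (X (j + 2 * k) u)" u,
        OF lin_Y 2 scl XY' X_ad_Y X_scale]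
    unfolding e_def by (simp add: algebra_simps)
qed

text \<open>Compared with \<open>exp_X\<close>, terms of odd order change sign and the quadratic
  term does not.\<close>

lemma exp_neg_X:
  assumes "nilp (X k)"
  defines "e \<equiv> nil_exp smul (\<lambda>u. - X k u)"
  shows "e (X j u) = X j (e u)"
    and "e (H j u) = H j (e u) + smul 2 (X (j + k) (e u))"
    and "e (Y j u) = Y j (e u) - H (j + k) (e u) - central j k (e u) - X (j + 2 * k) (e u)"
proof -
  note neg = lin_neg[OF lin_X[of k]] nilp_neg[OF lin_X[of k] assms(1)]
  note ad = nil_exp_ad[where A = "\<lambda>u. - X k u", OF neg]
  have scl: "lin (\<lambda>u. smul s (X j u))" for s j
    by (rule lin.linear_compose_scale_right[OF lin_X])
  have scale: "- X k (smul s (X j u)) = smul s (X j (- X k u))" for s j u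
    by (simp add: X_scale lin.linear_neg[OF lin_X])
  show "e (X j u) = X j (e u)"
    unfolding e_def using nil_exp_intertwine[of "\<lambda>u. - X k u" "\<lambda>u. - X k u" "X j"] neg lin_X XX[of j k]
    by (simp add: lin.linear_neg[OF lin_X])
  have 1: "- X k (H j u) = H j (- X k u) + smul 2 (X (j + k) u)" for u
    by (simp add: XH lin.linear_neg[OF lin_H])
  show "e (H j u) = H j (e u) + smul 2 (X (j + k) (e u))"
    using ad[of "H j" "\<lambda>u. smul 2 (X (j + k) u)" "\<lambda>_. 0" u] lin_H scl lin.linear_zero 1 scale
    unfolding e_def by (simp add: lin.linear_0[OF lin_X])
  let ?C = "\<lambda>u. - (H (j + k) u + central j k u)"
  have 2: "- X k (Y j u) = Y j (- X k u) + ?C u" for u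
    by (simp add: XY' lin.linear_neg[OF lin_Y])
  have 3: "- X k (?C u) = ?C (- X k u) + smul (- 2) (X (j + 2 * k) u)" for u
    using X_ad_Y[of k j u] by (simp add: lin.linear_neg[OF lin_X] lin.linear_neg[OF lin_H]
        lin.linear_neg[OF lin_central] lin.linear_diff[OF lin_X] lin.linear_add[OF lin_X] algebra_simps)
  have 4: "lin ?C"
    by (rule lin_neg[OF lin.linear_compose_add[OF lin_H lin_central]])
  show "e (Y j u) = Y j (e u) - H (j + k) (e u) - central j k (e u) - X (j + 2 * k) (e u)"
    using ad[of "Y j" ?C "\<lambda>u. smul (- 2) (X (j + 2 * k) u)" u, OF lin_Y 4 scl 2 3 scale]
    unfolding e_def by (simp add: algebra_simps)
qed

section \<open>Reflections and the basic translation\<close>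

definition refl :: "int \<Rightarrow> 'v \<Rightarrow> 'v"
  where "refl k u = nil_exp smul (\<lambda>u. - X k u) (nil_exp smul (Y (- k)) (nil_exp smul (\<lambda>u. - X k u) u))"

text \<open>The swapped \<open>refl\<close> at 1 is the reflection in
  \<open>\<delta> - \<alpha>\<^sub>1\<close>, so this is the translation by
  \<open>\<alpha>\<^sub>1\<close>.\<close>

definition translation :: "'v \<Rightarrow> 'v"
  where "translation u = level_one.refl smul Y X 1 (refl 0 u)"

lemma lin_refl: "nilp (X k) \<Longrightarrow> nilp (Y (- k)) \<Longrightarrow> lin (refl k)"
  unfolding refl_def
  using lin_comp[of "nil_exp smul (\<lambda>u. - X k u)"
      "\<lambda>u. nil_exp smul (Y (- k)) (nil_exp smul (\<lambda>u. - X k u) u)"]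
    lin_comp[of "nil_exp smul (Y (- k))" "nil_exp smul (\<lambda>u. - X k u)"]
    lin_nil_exp lin_neg nilp_neg lin_X lin_Y
  by simp

lemma refl_X_Y:
  assumes "nilp (X k)" "nilp (Y (- k))"
  shows "refl k (X j u) = - Y (j - 2 * k) (refl k u)"
    and "refl k (Y j u) = - X (j + 2 * k) (refl k u)"
proof -
  define e where "e = nil_exp smul (\<lambda>u. - X k u)"
  define f where "f = nil_exp smul (Y (- k))"
  have refl: "refl k u = e (f (e u))" for u
    by (simp add: refl_def e_def f_def)
  have l: "lin e" "lin f"
    unfolding e_def f_def by (intro lin_nil_exp lin_neg nilp_neg lin_X lin_Y assms)+
  note L = l[THEN lin.linear_add] l[THEN lin.linear_diff] l[THEN lin.linear_neg] l[THEN lin.linear_scale]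
  interpret s: level_one smul Y X "\<lambda>k u. - H k u"
    by (rule swap)
  note eX = exp_neg_X[OF assms(1), folded e_def]
  note fY = s.exp_X[OF assms(2), folded f_def]
  have ec: "e (central i m u) = central i m (e u)" for i m u
    by (simp add: central_def L)
  \<comment> \<open>The inner \<open>e\<close> commutes with \<open>X j\<close>; the outer one
    cancels everything but the \<open>Y\<close> term.\<close>
  have "refl k (X j u) = e (X j (f (e u)) - H (j - k) (f (e u)) + central j (- k) (f (e u))
      - Y (j - 2 * k) (f (e u)))"
    unfolding refl eX(1) fY(3) by (simp add: algebra_simps)
  also have "\<dots> = - Y (j - 2 * k) (refl k u)"
    unfolding refl L eX ec using scale_left_distrib[of 1 1] by (simp add: algebra_simps central_def)
  finally show "refl k (X j u) = - Y (j - 2 * k) (refl k u)" .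
  have fH: "f (H i u) = H i (f u) + smul 2 (Y (i - k) (f u))" for i u
    using fY(2)[of i u] by (simp add: L algebra_simps)
  have fc: "f (central i m u) = central i m (f u)" for i m u
    by (simp add: central_def L)
  \<comment> \<open>Here the cancellation is complete after \<open>f\<close>, and the outer
    \<open>e\<close> commutes with \<open>X\<close>.\<close>
  have "f (e (Y j u)) = - X (j + 2 * k) (f (e u))"
    unfolding eX L fc fH fY(1,3) using scale_left_distrib[of 1 1]
    by (simp add: algebra_simps central_def)
  then show "refl k (Y j u) = - X (j + 2 * k) (refl k u)"
    unfolding refl by (simp only: L eX)
qed

end

section \<open>Translation operators\<close>

locale vacuum = level_one smul X Y H
  for smul :: "complex \<Rightarrow> 'v::ab_group_add \<Rightarrow> 'v" and X Y H :: "int \<Rightarrow> 'v \<Rightarrow> 'v" +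
  fixes v :: 'v
  assumes X_v: "0 \<le> k \<Longrightarrow> X k v = 0" and Y_v: "0 \<le> k \<Longrightarrow> Y k v = 0" and H_v: "0 \<le> k \<Longrightarrow> H k v = 0"
    and generated: "\<lbrakk>subspace W; v \<in> W; \<And>k u. u \<in> W \<Longrightarrow> X k u \<in> W; \<And>k u. u \<in> W \<Longrightarrow> Y k u \<in> W\<rbrakk> \<Longrightarrow> W = UNIV"
begin

lemma vacuum_swap: "vacuum smul Y X (\<lambda>k u. - H k u) v"
  by (intro vacuum.intro swap vacuum_axioms.intro) (simp_all add: X_v Y_v H_v generated)

lemma nilp_X: "nilp_at (X k) v \<Longrightarrow> nilp (X k)"
  using generated[OF subspace_nilp_at[OF lin_X[of k]]] nilp_at_X[of k]
  by (auto simp: nilp_def)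

lemma nilp_Y: "nilp_at (Y k) v \<Longrightarrow> nilp (Y k)"
  by (rule vacuum.nilp_X[OF vacuum_swap])

text \<open>Agreement of \<open>A\<close> and \<open>B\<close> defines a subspace closed under all
  modes. \<open>P\<close> and \<open>Q\<close> are arbitrary so as to cover operators that exchange
  \<open>X\<close> and \<open>Y\<close>.\<close>

lemma linear_eq:
  assumes "lin A" "lin B" "A v = B v"
    and "\<And>k u. A (X k u) = P k (A u)" "\<And>k u. B (X k u) = P k (B u)"
    and "\<And>k u. A (Y k u) = Q k (A u)" "\<And>k u. B (Y k u) = Q k (B u)"
  shows "A u = B u"
proof -
  have "{u. A u = B u} = UNIV"
    by (rule generated, rule subspaceI)
      (use assms in \<open>auto simp: lin.linear_0 lin.linear_add lin.linear_scale\<close>)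
  then show ?thesis by blast
qed

text \<open>\<open>X N\<close>, \<open>Y (- N)\<close> and \<open>H 0 + N\<close> form an sl2 triple
  in which \<open>v\<close> has highest weight \<open>N\<close>; the reflection sends it to the
  lowest vector of its string.\<close>

lemma refl_vacuum:
  assumes "nilp (X (int N))" "nilp (Y (- int N))"
  shows "refl (int N) v = div_power smul (Y (- int N)) N v"
proof -
  let ?F = "Y (- int N)"
  have H: "H 0 ((?F ^^ p) v) = smul (- 2 * of_nat p) ((?F ^^ p) v)" for p
  proof (induction p)
    case (Suc p)
    have "H 0 ((?F ^^ Suc p) v) = smul (- 2 * of_nat p) ((?F ^^ Suc p) v) - smul 2 ((?F ^^ Suc p) v)"
      by (simp add: HY Suc lin.linear_neg[OF lin_Y] lin.linear_scale[OF lin_Y])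
    also have "\<dots> = smul (- 2 * of_nat (Suc p)) ((?F ^^ Suc p) v)"
      unfolding scale_left_diff_distrib[symmetric] by (simp del: funpow.simps)
    finally show ?case .
  qed (simp add: H_v)
  have E: "X (int N) (?F w) = ?F (X (int N) w) + H 0 w + smul (of_nat N) w" for w
    using XY[of "int N" "- int N" w] by simp
  have "X (int N) ((?F ^^ Suc p) v) = smul (of_nat (Suc p) * (of_nat N - of_nat p)) ((?F ^^ p) v)" for p
  proof (induction p)
    case 0
    then show ?case
      using E[of v] by (simp add: X_v H_v lin.linear_0[OF lin_Y])
  next
    case (Suc p)
    let ?w = "(?F ^^ Suc p) v"
    have "X (int N) ((?F ^^ Suc (Suc p)) v) = ?F (X (int N) ?w) + H 0 ?w + smul (of_nat N) ?w"
      using E[of ?w] by simp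
    also have "\<dots> = smul (of_nat (Suc p) * (of_nat N - of_nat p)) ?w
        + smul (- 2 * of_nat (Suc p)) ?w + smul (of_nat N) ?w"
      unfolding Suc H lin.linear_scale[OF lin_Y] by simp
    also have "\<dots> = smul (of_nat (Suc (Suc p)) * (of_nat N - of_nat (Suc p))) ?w"
      unfolding scale_left_distrib[symmetric]
      by (rule arg_cong[of _ _ "\<lambda>s. smul s _"]) (simp add: algebra_simps)
    finally show ?case .
  qed
  then show ?thesis
    unfolding refl_def
    by (intro reflection_extremal lin_X lin_Y assms X_v) simp_all
qed

end

text \<open>The added relation is \<open>f_0^2 v = 0\<close>. Together with the vacuum axioms it
  makes all four Chevalley generators nilpotent at \<open>v\<close>.\<close>

locale basic = vacuum smul X Y H v
  for smul :: "complex \<Rightarrow> 'v::ab_group_add \<Rightarrow> 'v" and X Y H :: "int \<Rightarrow> 'v \<Rightarrow> 'v" and v :: 'v +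
  assumes XX_v: "X (- 1) (X (- 1) v) = 0"
begin

abbreviation refl' :: "int \<Rightarrow> 'v \<Rightarrow> 'v"
  where "refl' \<equiv> level_one.refl smul Y X"

abbreviation translation' :: "'v \<Rightarrow> 'v"
  where "translation' \<equiv> level_one.translation smul Y X"

lemma nilp_base: "nilp (X 0)" "nilp (Y 0)" "nilp (Y 1)" "nilp (X (- 1))"
proof -
  show "nilp (X 0)" "nilp (Y 0)" "nilp (Y 1)"
    by (intro nilp_X nilp_Y exI[of _ 1]; simp add: X_v Y_v)+
  show "nilp (X (- 1))"
    by (intro nilp_X exI[of _ 2]) (simp add: numeral_2_eq_2 XX_v)
qed

text \<open>Nilpotency of the Chevalley generators already provides the reflections in
  \<open>\<alpha>\<^sub>1\<close> and \<open>\<delta> - \<alpha>\<^sub>1\<close>, and these carry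
  nilpotency from mode to mode.\<close>

lemma nilp_X_Y: "nilp (X k)" "nilp (Y k)"
proof -
  have lin': "lin (refl' 1)"
    using level_one.lin_refl[OF swap] nilp_base by simp
  have rX: "refl 0 (X j u) = - Y j (refl 0 u)" and rY: "refl 0 (Y j u) = - X j (refl 0 u)" for j u
    using refl_X_Y[of 0] nilp_base by simp_all
  have rX': "refl' 1 (X j u) = - Y (j + 2) (refl' 1 u)" and rY': "refl' 1 (Y j u) = - X (j - 2) (refl' 1 u)" for j u
    using level_one.refl_X_Y[OF swap, of 1] nilp_base by simp_all
  have r: "refl 0 v = v"
    using refl_vacuum[of 0] nilp_base by (simp add: div_power_def)
  have r': "refl' 1 v = X (- 1) v"
    using vacuum.refl_vacuum[OF vacuum_swap, of 1] nilp_base by (simp add: div_power_def)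
  \<comment> \<open>\<open>Y 1\<close> leads from \<open>refl' 1 v\<close> back to \<open>v\<close>,
    where nilpotency has to be tested.\<close>
  have YX: "Y 1 (X (- 1) v) = v"
    using XY[of "-1" 1 v] by (simp add: Y_v H_v lin.linear_0[OF lin_X])
  have XtoY: "nilp (Y j)" if "nilp (X j)" for j
    using nilp_at_intertwine[of "X j" "Y j" "refl 0" v, OF lin_X lin_Y lin_refl rX] that nilp_base r
    by (auto simp: nilp_def intro!: nilp_Y[unfolded nilp_def])
  have YtoX: "nilp (X j)" if "nilp (Y j)" for j
    using nilp_at_intertwine[of "Y j" "X j" "refl 0" v, OF lin_Y lin_X lin_refl rY] that nilp_base r
    by (auto simp: nilp_def intro!: nilp_X[unfolded nilp_def])
  have up: "nilp (X (j + 2))" if "nilp (X j)" for j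
  proof (intro YtoX nilp_Y)
    have "nilp_at (Y (j + 2)) (refl' 1 v)"
      using nilp_at_intertwine[of "X j" "Y (j + 2)" "refl' 1" v, OF lin_X lin_Y lin' rX'] that by (auto simp: nilp_def)
    then have "nilp_at (Y (j + 2)) (Y 1 (X (- 1) v))"
      unfolding r' by (rule level_one.nilp_at_X(1)[OF swap])
    then show "nilp_at (Y (j + 2)) v"
      unfolding YX .
  qed
  have down: "nilp (X (j - 2))" if "nilp (X j)" for j
  proof (intro nilp_X)
    have "nilp_at (X (j - 2)) (refl' 1 v)"
      using nilp_at_intertwine[of "Y j" "X (j - 2)" "refl' 1" v, OF lin_Y lin_X lin' rY'] XtoY[OF that] by (auto simp: nilp_def)
    then have "nilp_at (X (j - 2)) (Y 1 (X (- 1) v))"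
      unfolding r' by (rule nilp_at_X(2))
    then show "nilp_at (X (j - 2)) v"
      unfolding YX .
  qed
  \<comment> \<open>The modes 0 and -1 represent both parities, and \<open>up\<close> and
    \<open>down\<close> move by two.\<close>
  have "nilp (X (2 * i)) \<and> nilp (X (2 * i - 1))" for i
  proof (induction i rule: int_induct[where k = 0])
    case base
    then show ?case using nilp_base by simp
  next
    case (step1 i)
    then show ?case
      using up[of "2 * i"] up[of "2 * i - 1"] by (simp add: algebra_simps)
  next
    case (step2 i)
    then show ?case
      using down[of "2 * i"] down[of "2 * i - 1"] by (simp add: algebra_simps)
  qed
  moreover have "\<exists>i. k = 2 * i \<or> k = 2 * i - 1"
    by presburger
  ultimately show "nilp (X k)" by metis
  then show "nilp (Y k)" by (rule XtoY)
qed

lemma linear_refl: "lin (refl k)" and linear_refl': "lin (refl' k)"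
  using lin_refl level_one.lin_refl[OF swap] nilp_X_Y by simp_all

lemma refl_X: "refl k (X j u) = - Y (j - 2 * k) (refl k u)"
  and refl_Y: "refl k (Y j u) = - X (j + 2 * k) (refl k u)"
  and refl'_X: "refl' k (X j u) = - Y (j + 2 * k) (refl' k u)"
  and refl'_Y: "refl' k (Y j u) = - X (j - 2 * k) (refl' k u)"
  using refl_X_Y level_one.refl_X_Y[OF swap] nilp_X_Y by simp_all

lemma refl0_v: "refl 0 v = v"
  using refl_vacuum[of 0] nilp_X_Y by (simp add: div_power_def)

lemma refl'_v: "refl' (int N) v = div_power smul (X (- int N)) N v"
  using vacuum.refl_vacuum[OF vacuum_swap, of N] nilp_X_Y by simp

text \<open>\<open>refl 0\<close> fixes \<open>v\<close> and turns \<open>X (- 1)\<close> into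
  \<open>- Y (- 1)\<close>, so it maps \<open>XX_v\<close> to its mirror image.\<close>

lemma basic_swap: "basic smul Y X (\<lambda>k u. - H k u) v"
proof (intro basic.intro vacuum_swap basic_axioms.intro)
  have "Y (- 1) (Y (- 1) v) = refl 0 (X (- 1) (X (- 1) v))"
    by (simp add: refl_X refl0_v lin.linear_neg[OF lin_Y])
  then show "Y (- 1) (Y (- 1) v) = 0"
    by (simp add: XX_v lin.linear_0[OF linear_refl])
qed

section \<open>Translations and relations between reflections\<close>

lemma lin_translation: "lin translation"
  unfolding translation_def[abs_def] by (rule lin_comp[OF linear_refl' linear_refl])

lemma translation_X: "translation (X j u) = X (j - 2) (translation u)"
  and translation_Y: "translation (Y j u) = Y (j + 2) (translation u)"
  by (simp_all add: translation_def refl_X refl_Y refl'_X refl'_Y lin.linear_neg[OF linear_refl'])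

lemma translation_v: "translation v = X (- 1) v"
  using refl'_v[of 1] by (simp add: translation_def refl0_v div_power_def)

lemmas lin_translation' = basic.lin_translation[OF basic_swap]
  and translation'_X = basic.translation_Y[OF basic_swap]
  and translation'_Y = basic.translation_X[OF basic_swap]
  and translation'_v = basic.translation_v[OF basic_swap]

lemma translation'_translation: "translation' (translation u) = u"
proof (rule linear_eq[where A = "\<lambda>u. translation' (translation u)" and B = "\<lambda>u. u" and P = X and Q = Y])
  show "lin (\<lambda>u. translation' (translation u))"
    by (rule lin_comp[OF lin_translation' lin_translation])
  show "lin (\<lambda>u. u)"
    by (rule linI) simp_all
  have "translation' (translation v) = X 1 (Y (- 1) v)"
    by (simp add: translation_v translation'_X translation'_v)
  \<comment> \<open>At level one the bracket of \<open>X 1\<close> and \<open>Y (- 1)\<close> acts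
    on \<open>v\<close> as the identity.\<close>
  also have "\<dots> = v"
    using XY[of 1 "-1" v] by (simp add: X_v H_v lin.linear_0[OF lin_Y])
  finally show "translation' (translation v) = v" .
qed (simp_all add: translation_X translation_Y translation'_X translation'_Y)

lemmas translation_translation' = basic.translation'_translation[OF basic_swap]

lemma refl'_0: "refl' 0 u = refl 0 u"
  by (rule linear_eq[where P = "\<lambda>k u. - Y k u" and Q = "\<lambda>k u. - X k u"])
    (simp_all add: linear_refl linear_refl' refl0_v basic.refl0_v[OF basic_swap] refl_X refl_Y refl'_X refl'_Y)

text \<open>On each mode two signs cancel, and \<open>v\<close> is fixed; the square is
  \<open>(-1)^h\<close> on a module with even \<open>h\<close>-weights.\<close>

lemma refl0_refl0: "refl 0 (refl 0 u) = u"
proof (rule linear_eq[where A = "\<lambda>u. refl 0 (refl 0 u)" and B = "\<lambda>u. u" and P = X and Q = Y])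
  show "lin (\<lambda>u. refl 0 (refl 0 u))"
    by (rule lin_comp[OF linear_refl linear_refl])
  show "lin (\<lambda>u. u)"
    by (rule linI) simp_all
qed (simp_all add: refl0_v refl_X refl_Y lin.linear_neg[OF linear_refl])

text \<open>Both sides pass the modes alike, so the sign is decided at \<open>v\<close>:
  \<open>refl 0\<close> takes \<open>Y (- 1) v\<close> to \<open>- X (- 1) v\<close>.\<close>

lemma refl0_translation': "refl 0 (translation' u) = - translation (refl 0 u)"
proof (rule linear_eq[where A = "\<lambda>u. refl 0 (translation' u)" and B = "\<lambda>u. - translation (refl 0 u)"
      and P = "\<lambda>k u. - Y (k + 2) u" and Q = "\<lambda>k u. - X (k - 2) u"])
  show "lin (\<lambda>u. refl 0 (translation' u))"
    by (rule lin_comp[OF linear_refl lin_translation'])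
  show "lin (\<lambda>u. - translation (refl 0 u))"
    by (rule lin_neg[OF lin_comp[OF lin_translation linear_refl]])
qed (simp_all add: refl0_v refl_X refl_Y translation_X translation_Y translation'_X translation'_Y
    translation_v translation'_v lin.linear_neg[OF lin_translation] lin.linear_neg[OF lin_X] lin.linear_neg[OF lin_Y])

text \<open>Conjugation by \<open>translation\<close> moves \<open>Y k\<close> to
  \<open>Y (k + 2)\<close> and \<open>X (- k)\<close> to \<open>X (- k - 2)\<close>, hence the three
  exponentials of one reflection to those of the other.\<close>

lemma refl'_shift: "refl' (k + 2) (translation u) = translation (refl' k u)"
proof -
  note neg = lin_neg[OF lin_Y] nilp_neg[OF lin_Y nilp_X_Y(2)]
  have Y: "translation (nil_exp smul (\<lambda>u. - Y k u) u) = nil_exp smul (\<lambda>u. - Y (k + 2) u) (translation u)" for u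
    using nil_exp_intertwine[of "\<lambda>u. - Y k u" "\<lambda>u. - Y (k + 2) u" translation] neg lin_translation
    by (simp add: lin.linear_neg[OF lin_translation] translation_Y)
  have X: "translation (nil_exp smul (X (- k)) u) = nil_exp smul (X (- (k + 2))) (translation u)" for u
    using nil_exp_intertwine[of "X (- k)" "X (- (k + 2))" translation] lin_X nilp_X_Y lin_translation
    by (simp add: translation_X)
  show ?thesis
    unfolding level_one.refl_def[OF swap] X Y ..
qed

text \<open>
  Writing \<open>R\<^sub>N\<close> for the reflection in \<open>N\<delta> - \<alpha>\<^sub>1\<close>, we have \<open>R\<^bsub>N+2\<^esub> = T R\<^sub>N T\<^sup>-\<^sup>1\<close>; moving \<open>T\<^sup>-\<^sup>1\<close> past
  \<open>r\<close> by \<open>r T\<^sup>-\<^sup>1 = - T r\<close> produces one sign for every two steps.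
\<close>

lemma refl'_eq: "refl' (int N) u = smul ((-1) ^ (N div 2)) ((translation ^^ N) (refl 0 u))"
proof (induction N arbitrary: u rule: induct_nat_012)
  case 0
  then show ?case by (simp add: refl'_0)
next
  case 1
  then show ?case by (simp add: translation_def refl0_refl0)
next
  case (ge2 N)
  \<comment> \<open>\<open>T T^(-1)\<close> is inserted so that \<open>refl'_shift\<close>
    applies.\<close>
  have "refl' (int (Suc (Suc N))) u = refl' (int N + 2) (translation (translation' u))"
    by (simp add: translation_translation' algebra_simps)
  also have "\<dots> = smul ((-1) ^ (N div 2)) (translation ((translation ^^ N) (- translation (refl 0 u))))"
    by (simp add: refl'_shift ge2(1) lin.linear_scale[OF lin_translation] refl0_translation')
  also have "\<dots> = smul ((-1) ^ (Suc (Suc N) div 2)) ((translation ^^ Suc (Suc N)) (refl 0 u))"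
    by (simp add: lin.linear_neg[OF lin_funpow[OF lin_translation]] lin.linear_neg[OF lin_translation]
        funpow_swap1)
  finally show ?case .
qed

text \<open>The reflection identity at \<open>v\<close>, which \<open>refl 0\<close> fixes; the left
  side is \<open>w_n\<close> for \<open>n = 2 N\<close>.\<close>

lemma extremal_eq: "div_power smul (X (- int N)) N v = smul ((-1) ^ (N div 2)) ((translation ^^ N) v)"
  using refl'_eq[of N v] by (simp add: refl'_v refl0_v)

section \<open>Translations by all integer multiples of the simple root\<close>

definition int_translation :: "int \<Rightarrow> 'v \<Rightarrow> 'v"
  where "int_translation b = (if b \<ge> 0 then translation ^^ nat b else translation' ^^ nat (- b))"

lemma lin_int_translation: "lin (int_translation b)"
  by (simp add: int_translation_def lin_funpow lin_translation lin_translation')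

lemma int_translation_Y: "int_translation b (Y j u) = Y (j + 2 * b) (int_translation b u)"
proof -
  have 1: "(translation ^^ m) (Y j u) = Y (j + 2 * int m) ((translation ^^ m) u)" for m
    by (induction m) (simp_all add: translation_Y algebra_simps)
  have 2: "(translation' ^^ m) (Y j u) = Y (j - 2 * int m) ((translation' ^^ m) u)" for m
    by (induction m) (simp_all add: translation'_Y algebra_simps)
  show ?thesis
    by (simp add: int_translation_def 1 2)
qed

text \<open>For negative \<open>b\<close> the inverse translations cancel against
  \<open>translation\<close>; the bound ensures that there are enough factors to cancel.\<close>

lemma int_translation_funpow:
  assumes "int m + b \<ge> 0"
  shows "int_translation b ((translation ^^ m) u) = (translation ^^ nat (int m + b)) u"
proof (cases "b \<ge> 0")
  case True
  then have "nat (int m + b) = nat b + m" by simp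
  with True show ?thesis
    by (simp add: int_translation_def funpow_add)
next
  case False
  have "(translation' ^^ j) ((translation ^^ m) u) = (translation ^^ (m - j)) u" if "j \<le> m" for j
    using that
  proof (induction j)
    case (Suc j)
    then have "m - j = Suc (m - Suc j)" by simp
    with Suc show ?case by (simp add: translation'_translation)
  qed simp
  from this[of "nat (- b)"] assms False
  have "int_translation b ((translation ^^ m) u) = (translation ^^ (m - nat (- b))) u"
    by (simp add: int_translation_def nat_le_iff)
  moreover have "m - nat (- b) = nat (int m + b)"
    using assms False by linarith
  ultimately show ?thesis by simp
qed

end

section \<open>The level one module of highest weight \<open>\<Lambda>\<^sub>0\<close>\<close>

lemma sl2_mats: "mat_x \<in> sl2" "mat_y \<in> sl2" "mat_h \<in> sl2"
  by (simp_all add: sl2_def trace_def sum_2 mat_x_def mat_y_def mat_h_def)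

lemmas mat2_simps = vec_eq_iff forall_2 matrix_matrix_mult_def sum_2 vector_2 mat_x_def mat_y_def
  mat_h_def commutator_def smat_def map_matrix_def trace_def

lemma commutators:
  "commutator mat_x mat_x = 0" "commutator mat_y mat_y = 0" "commutator mat_x mat_y = mat_h"
  "commutator mat_h mat_x = smat 2 mat_x" "commutator mat_h mat_y = smat (- 2) mat_y"
  by (simp_all add: mat2_simps)

lemma traces:
  "trace (mat_x ** mat_x) = 0" "trace (mat_y ** mat_y) = 0" "trace (mat_x ** mat_y) = 1"
  "trace (mat_h ** mat_x) = 0" "trace (mat_h ** mat_y) = 0"
  by (simp_all add: mat2_simps)

lemma sl2_decomp:
  assumes "A \<in> sl2"
  shows "A = smat (A $ 1 $ 2) mat_x + (smat (A $ 1 $ 1) mat_h + smat (A $ 2 $ 1) mat_y)"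
  using assms by (simp add: sl2_def mat2_simps add_eq_0_iff)

lemma tpow_add: "tpow (A + B) k = aff_add (tpow A k) (tpow B k)"
  by (auto simp: tpow_def aff_add_def)

lemma tpow_smat: "tpow (smat s A) k = aff_scale s (tpow A k)"
  by (auto simp: tpow_def aff_scale_def smat_def map_matrix_def vec_eq_iff)

lemma tpow_mem: "A \<in> sl2 \<Longrightarrow> tpow A k \<in> affine_sl2"
  by (auto simp: affine_sl2_def tpow_def sl2_def trace_def)

lemma sl2_closed: "A \<in> sl2 \<Longrightarrow> B \<in> sl2 \<Longrightarrow> A + B \<in> sl2" "A \<in> sl2 \<Longrightarrow> smat s A \<in> sl2"
  by (auto simp: sl2_def trace_def sum_2 smat_def map_matrix_def algebra_simps simp flip: distrib_left)

lemma affine_closed: "a \<in> affine_sl2 \<Longrightarrow> b \<in> affine_sl2 \<Longrightarrow> aff_add a b \<in> affine_sl2"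
  "a \<in> affine_sl2 \<Longrightarrow> aff_scale s a \<in> affine_sl2"
proof -
  show "aff_scale s a \<in> affine_sl2" if "a \<in> affine_sl2"
  proof -
    have "{m. smat s (loop a m) \<noteq> 0} \<subseteq> {m. loop a m \<noteq> 0}"
      by (auto simp: smat_def map_matrix_def vec_eq_iff)
    then show ?thesis
      using that by (auto simp: affine_sl2_def aff_scale_def sl2_closed intro: finite_subset)
  qed
  show "aff_add a b \<in> affine_sl2" if "a \<in> affine_sl2" "b \<in> affine_sl2"
  proof -
    have "{m. loop a m + loop b m \<noteq> 0} \<subseteq> {m. loop a m \<noteq> 0} \<union> {m. loop b m \<noteq> 0}"
      by auto
    then show ?thesis
      using that by (auto simp: affine_sl2_def aff_add_def sl2_closed intro: finite_subset)
  qed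
qed

lemma affine_mem_c_d: "aff_c \<in> affine_sl2" "aff_d \<in> affine_sl2"
  by (auto simp: affine_sl2_def aff_c_def aff_d_def sl2_def trace_def)

lemma cartan_mem: "tpow mat_h 0 \<in> cartan" "aff_c \<in> cartan" "aff_d \<in> cartan"
proof -
  have *: "aff_add (aff_scale p (tpow mat_h 0)) (aff_add (aff_scale q aff_c) (aff_scale s aff_d)) \<in> cartan" for p q s
    unfolding cartan_def by blast
  have "tpow mat_h 0 = aff_add (aff_scale 1 (tpow mat_h 0)) (aff_add (aff_scale 0 aff_c) (aff_scale 0 aff_d))"
    by (auto simp: aff_add_def aff_scale_def tpow_def aff_c_def aff_d_def smat_def map_matrix_def
        vec_eq_iff)
  then show "tpow mat_h 0 \<in> cartan"
    using *[of 1 0 0] by simp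
  show "aff_c \<in> cartan"
    using *[of 0 1 0] by (simp add: aff_add_def aff_scale_def tpow_def aff_c_def aff_d_def smat_def
        map_matrix_def zero_vec_def[symmetric] if_distrib cong: if_cong)
  show "aff_d \<in> cartan"
    using *[of 0 0 1] by (simp add: aff_add_def aff_scale_def tpow_def aff_c_def aff_d_def smat_def
        map_matrix_def zero_vec_def[symmetric] if_distrib cong: if_cong)
qed

text \<open>The loop part is reduced one power of \<open>t\<close> at a time and each coefficient is
  split along the basis; what remains is a combination of \<open>c\<close> and
  \<open>d\<close>.\<close>

lemma affine_induct [consumes 1, case_names x y h c d add scale]:
  assumes "a \<in> affine_sl2"
    and tpow: "\<And>k. P (tpow mat_x k)" "\<And>k. P (tpow mat_y k)" "\<And>k. P (tpow mat_h k)"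
    and cd: "P aff_c" "P aff_d"
    and add: "\<And>a b. a \<in> affine_sl2 \<Longrightarrow> b \<in> affine_sl2 \<Longrightarrow> P a \<Longrightarrow> P b \<Longrightarrow> P (aff_add a b)"
    and scale: "\<And>s a. a \<in> affine_sl2 \<Longrightarrow> P a \<Longrightarrow> P (aff_scale s a)"
  shows "P a"
proof -
  have sl2: "P (tpow A k)" if "A \<in> sl2" for A k
    by (subst sl2_decomp[OF that], unfold tpow_add tpow_smat)
      (intro add scale tpow affine_closed tpow_mem sl2_mats)
  \<comment> \<open>\<open>F\<close> need only contain the support, so clearing the coefficient at
    \<open>m\<close> always fits the smaller set.\<close>
  have "P (Aff l \<mu> \<nu>)" if "finite F" "\<forall>m. l m \<in> sl2" "{m. l m \<noteq> 0} \<subseteq> F" for F l \<mu> \<nu>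
    using that
  proof (induction F arbitrary: l)
    case empty
    then have l: "l = (\<lambda>_. 0)" by auto
    have "Aff l \<mu> \<nu> = aff_add (aff_scale \<mu> aff_c) (aff_scale \<nu> aff_d)"
      unfolding l by (simp add: aff_add_def aff_scale_def aff_c_def aff_d_def smat_def
          map_matrix_def zero_vec_def[symmetric])
    then show ?case
      by (simp only:) (intro add scale cd affine_closed affine_mem_c_d)
  next
    case (insert m F)
    let ?l = "l(m := 0)"
    have "Aff l \<mu> \<nu> = aff_add (Aff ?l \<mu> \<nu>) (tpow (l m) m)"
      by (auto simp: aff_add_def tpow_def)
    moreover have l: "\<forall>i. ?l i \<in> sl2" "{i. ?l i \<noteq> 0} \<subseteq> F"
      using insert.prems by (auto simp: sl2_def trace_def)
    moreover have "Aff ?l \<mu> \<nu> \<in> affine_sl2"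
      using l(1) finite_subset[OF l(2) insert.hyps(1)] by (simp only: affine_sl2_def mem_Collect_eq aff.sel simp_thms)
    ultimately show ?case
      using insert.prems by (simp only:) (intro add insert.IH tpow_mem sl2; simp)
  qed
  from this[of "{m. loop a m \<noteq> 0}" "loop a" "c_coeff a" "d_coeff a"] assms(1) show ?thesis
    by (simp add: affine_sl2_def)
qed

section \<open>The action on a module\<close>

context affine_module
begin

lemma act_zero: "act (tpow 0 k) u = 0" "act (Aff (\<lambda>_. 0) 0 0) u = 0"
proof -
  have z: "Aff (\<lambda>_. 0) 0 0 \<in> affine_sl2"
    by (simp add: affine_sl2_def sl2_def trace_def)
  have "aff_scale 0 (Aff (\<lambda>_. 0) 0 0) = Aff (\<lambda>_. 0) 0 0"
    by (simp add: aff_scale_def smat_def map_matrix_def zero_vec_def[symmetric])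
  with act_scale[OF z, of 0 u] show "act (Aff (\<lambda>_. 0) 0 0) u = 0"
    by simp
  then show "act (tpow 0 k) u = 0"
    by (simp add: tpow_def)
qed

lemma act_tpow_commute:
  assumes "A \<in> sl2" "B \<in> sl2" "commutator A B \<in> sl2"
  shows "act (tpow A m) (act (tpow B n) u) = act (tpow B n) (act (tpow A m) u)
    + act (tpow (commutator A B) (m + n)) u
    + smul (if m = - n then of_int m * trace (A ** B) else 0) (act aff_c u)"
  using act_bracket[OF tpow_mem[OF assms(1), of m] tpow_mem[OF assms(2), of n], of u]
  unfolding bracket_tpow_tpow
    act_add[OF tpow_mem[OF assms(3)] affine_closed(2)[OF affine_mem_c_d(1)]] act_scale[OF affine_mem_c_d(1)]
  by (simp add: algebra_simps)

lemma act_c_commute: "a \<in> affine_sl2 \<Longrightarrow> act aff_c (act a u) = act a (act aff_c u)"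
  using act_bracket[OF affine_mem_c_d(1), of a u] by (simp add: bracket_c act_zero)

lemma act_d_commute:
  assumes "A \<in> sl2"
  shows "act aff_d (act (tpow A m) u) = act (tpow A m) (act aff_d u) + smul (of_int m) (act (tpow A m) u)"
  using act_bracket[OF affine_mem_c_d(2) tpow_mem[OF assms, of m], of u]
  by (simp add: bracket_d_tpow act_scale tpow_mem assms algebra_simps)

end

lemma (in vector_space) span_closed:
  assumes "Vector_Spaces.linear scale scale A" "\<And>w. w \<in> S \<Longrightarrow> A w \<in> span S" "w \<in> span S"
  shows "A w \<in> span S"
proof -
  interpret p: vector_space_pair scale scale by unfold_locales
  have "subspace {w. A w \<in> span S}"
    by (rule subspaceI) (simp_all add: p.linear_0[OF assms(1)] p.linear_add[OF assms(1)]
        p.linear_scale[OF assms(1)] span_zero span_add span_scale)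
  from span_induct[OF assms(3) this] assms(2) show ?thesis by simp
qed

locale basic_affine_module = irreducible_highest_weight_module smul act Lambda0 v
  for smul :: "complex \<Rightarrow> 'v::ab_group_add \<Rightarrow> 'v" and act :: "aff \<Rightarrow> 'v \<Rightarrow> 'v" and v :: 'v
begin

abbreviation "X k \<equiv> act (tpow mat_x k)"
abbreviation "Y k \<equiv> act (tpow mat_y k)"
abbreviation "H k \<equiv> act (tpow mat_h k)"
abbreviation "D \<equiv> act aff_d"

lemma weight_v: "H 0 v = 0" "act aff_c v = v" "D v = 0"
  using weight[OF cartan_mem(1)] weight[OF cartan_mem(2)] weight[OF cartan_mem(3)]
  by (simp_all add: Lambda0_values)

sublocale complex_space smul
  by unfold_locales

text \<open>Since \<open>c\<close> is central, its fixed vectors form a submodule, and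
  \<open>v\<close> is one of them.\<close>

lemma act_c: "act aff_c u = u"
proof -
  note L = act_linear[OF affine_mem_c_d(1)]
  have "submodule {u. act aff_c u = u}"
    unfolding submodule_def
    by (auto intro!: subspaceI simp: lin.linear_0[OF L] lin.linear_add[OF L] lin.linear_scale[OF L]
        act_c_commute)
  from generates[OF this] weight_v(2) show ?thesis by auto
qed

lemmas commute = act_tpow_commute[unfolded act_c]

sublocale level_one smul X Y H
proof (intro level_one.intro complex_space_axioms level_one_axioms.intro)
  fix j k :: int and u :: 'v
  show "lin (X k)" "lin (Y k)" "lin (H k)"
    by (intro act_linear tpow_mem sl2_mats)+
  have "0 \<in> sl2"
    by (simp add: sl2_def trace_def)
  note [simp] = commutators traces act_zero this
  show "X j (X k u) = X k (X j u)"
    using commute[of mat_x mat_x j k u] sl2_mats by (simp cong: if_cong)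
  show "Y j (Y k u) = Y k (Y j u)"
    using commute[of mat_y mat_y j k u] sl2_mats by (simp cong: if_cong)
  show "H j (X k u) = X k (H j u) + smul 2 (X (j + k) u)"
    using commute[of mat_h mat_x j k u] sl2_mats
    by (simp add: sl2_closed tpow_smat act_scale tpow_mem)
  show "H j (Y k u) = Y k (H j u) - smul 2 (Y (j + k) u)"
    using commute[of mat_h mat_y j k u] sl2_mats
    by (simp add: sl2_closed tpow_smat act_scale tpow_mem)
  show "X j (Y k u) = Y k (X j u) + H (j + k) u + smul (if j = - k then of_int j else 0) u"
    using commute[of mat_x mat_y j k u] sl2_mats by simp
qed

lemma DX: "D (X k u) = X k (D u) + smul (of_int k) (X k u)"
  and DY: "D (Y k u) = Y k (D u) + smul (of_int k) (Y k u)"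
  by (intro act_d_commute sl2_mats)+

lemma lin_D: "lin D"
  by (rule act_linear[OF affine_mem_c_d(2)])

text \<open>The four operators are the Chevalley generators. Their brackets include
  \<open>H 1\<close> and \<open>H (- 1)\<close>, which shift the modes of \<open>X\<close> and
  \<open>Y\<close> by one in either direction.\<close>

lemma subspace_closed_X_Y:
  assumes W: "subspace W"
    and gen: "\<And>w. w \<in> W \<Longrightarrow> X 0 w \<in> W" "\<And>w. w \<in> W \<Longrightarrow> Y 1 w \<in> W"
      "\<And>w. w \<in> W \<Longrightarrow> X (- 1) w \<in> W" "\<And>w. w \<in> W \<Longrightarrow> Y 0 w \<in> W" and "w \<in> W"
  shows "X k w \<in> W" "Y k w \<in> W"
proof -
  note sub = subspace_diff[OF W] subspace_scale[OF W]
  have H1: "H 1 w \<in> W" if "w \<in> W" for w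
  proof -
    have "H 1 w = X 0 (Y 1 w) - Y 1 (X 0 w)"
      using XY[of 0 1 w] by simp
    then show ?thesis using that by (simp add: sub gen)
  qed
  have Hm: "H (- 1) w \<in> W" if "w \<in> W" for w
  proof -
    have "H (- 1) w = X (- 1) (Y 0 w) - Y 0 (X (- 1) w)"
      using XY[of "-1" 0 w] by simp
    then show ?thesis using that by (simp add: sub gen)
  qed
  have X: "X (k + i) w \<in> W" if "\<And>w. w \<in> W \<Longrightarrow> H i w \<in> W" "\<And>w. w \<in> W \<Longrightarrow> X k w \<in> W" "w \<in> W" for k i w
  proof -
    have "X (k + i) w = smul (1 / 2) (H i (X k w) - X k (H i w))"
      using HX[of i k w] by (simp add: add.commute)
    then show ?thesis using that by (simp add: sub)
  qed
  have Y: "Y (k + i) w \<in> W" if "\<And>w. w \<in> W \<Longrightarrow> H i w \<in> W" "\<And>w. w \<in> W \<Longrightarrow> Y k w \<in> W" "w \<in> W" for k i w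
  proof -
    have "Y (k + i) w = smul (1 / 2) (Y k (H i w) - H i (Y k w))"
      using HY[of i k w] by (simp add: add.commute)
    then show ?thesis using that by (simp add: sub)
  qed
  have "\<forall>w\<in>W. X k w \<in> W" "\<forall>w\<in>W. Y k w \<in> W"
    by (induction k rule: int_induct[where k = 0])
      (use X[OF H1] X[OF Hm] Y[OF H1] Y[OF Hm] gen in auto)
  with \<open>w \<in> W\<close> show "X k w \<in> W" "Y k w \<in> W"
    by auto
qed

lemma submoduleI:
  assumes W: "subspace W"
    and gen: "\<And>w. w \<in> W \<Longrightarrow> X 0 w \<in> W" "\<And>w. w \<in> W \<Longrightarrow> Y 1 w \<in> W"
      "\<And>w. w \<in> W \<Longrightarrow> X (- 1) w \<in> W" "\<And>w. w \<in> W \<Longrightarrow> Y 0 w \<in> W"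
    and D: "\<And>w. w \<in> W \<Longrightarrow> D w \<in> W"
  shows "submodule W"
  unfolding submodule_def
proof (intro conjI ballI W)
  note XYW = subspace_closed_X_Y[OF W gen]
  fix a u assume "a \<in> affine_sl2" "u \<in> W"
  then show "act a u \<in> W"
  proof (induction a rule: affine_induct)
    case (h k)
    \<comment> \<open>The central term is zero even for \<open>k = 0\<close>.\<close>
    have "H k u = X k (Y 0 u) - Y 0 (X k u)"
      using XY[of k 0 u] by (cases "k = 0") simp_all
    with h show ?case
      by (simp add: subspace_diff[OF W] XYW)
  qed (simp_all add: XYW act_c D act_add act_scale subspace_add[OF W] subspace_scale[OF W])
qed

section \<open>Singular vectors and irreducibility\<close>

inductive_set words :: "'v \<Rightarrow> 'v set" for u where
  base: "u \<in> words u"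
| f0: "w \<in> words u \<Longrightarrow> X (- 1) w \<in> words u"
| f1: "w \<in> words u \<Longrightarrow> Y 0 w \<in> words u"

text \<open>\<open>4 d + h\<close> is twice the principal degree: \<open>f_0\<close> changes
  \<open>(d, h)\<close> by \<open>(-1, 2)\<close> and \<open>f_1\<close> by \<open>(0, -2)\<close>,
  so \<open>n\<close> counts letters.\<close>

lemma words_weight:
  assumes "H 0 u = smul a u" "D u = smul b u" "w \<in> words u"
  shows "\<exists>a' b' n. H 0 w = smul a' w \<and> D w = smul b' w \<and> 4 * b' + a' = 4 * b + a - 2 * of_nat n"
  using assms(3)
proof induction
  case base
  then show ?case
    using assms by (intro exI[of _ a] exI[of _ b] exI[of _ 0]) simp
next
  case (f0 w)
  then obtain a' b' n where *: "H 0 w = smul a' w" "D w = smul b' w" "4 * b' + a' = 4 * b + a - 2 * of_nat n"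
    by blast
  then have "H 0 (X (- 1) w) = smul (a' + 2) (X (- 1) w)" "D (X (- 1) w) = smul (b' - 1) (X (- 1) w)"
    by (simp_all add: HX DX lin.linear_scale[OF lin_X] scale_left_distrib scale_left_diff_distrib)
  moreover have "4 * (b' - 1) + (a' + 2) = 4 * b + a - 2 * of_nat (Suc n)"
    using *(3) by (simp add: algebra_simps)
  ultimately show ?case by blast
next
  case (f1 w)
  then obtain a' b' n where *: "H 0 w = smul a' w" "D w = smul b' w" "4 * b' + a' = 4 * b + a - 2 * of_nat n"
    by blast
  then have "H 0 (Y 0 w) = smul (a' - 2) (Y 0 w)" "D (Y 0 w) = smul b' (Y 0 w)"
    by (simp_all add: HY DY lin.linear_scale[OF lin_Y] scale_left_distrib scale_left_diff_distrib)
  moreover have "4 * b' + (a' - 2) = 4 * b + a - 2 * of_nat (Suc n)"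
    using *(3) by (simp add: algebra_simps)
  ultimately show ?case by blast
qed

text \<open>Moving \<open>e_0\<close> or \<open>e_1\<close> past a letter of a word leaves at most a
  multiple of the rest, and at the end it kills \<open>u\<close>.\<close>

lemma submodule_span_words:
  assumes "X 0 u = 0" "Y 1 u = 0" and wt: "H 0 u = smul a u" "D u = smul b u"
  shows "submodule (span (words u))"
proof (rule submoduleI)
  let ?W = "span (words u)"
  show X: "X (- 1) w \<in> ?W" if "w \<in> ?W" for w
    by (rule span_closed[OF lin_X _ that]) (intro span_base words.f0)
  show Y: "Y 0 w \<in> ?W" if "w \<in> ?W" for w
    by (rule span_closed[OF lin_Y _ that]) (intro span_base words.f1)
  have H: "H 0 w \<in> ?W" "D w \<in> ?W" if "w \<in> words u" for w
    using words_weight[OF wt that] span_scale[OF span_base[OF that]] by auto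
  then show "D w \<in> ?W" if "w \<in> ?W" for w
    using span_closed[OF lin_D _ that] by blast
  have e: "X 0 w \<in> ?W \<and> Y 1 w \<in> ?W" if "w \<in> words u" for w
    using that
  proof induction
    case base
    then show ?case using assms by (simp add: span_zero)
  next
    case (f0 w)
    have "X 0 (X (- 1) w) = X (- 1) (X 0 w)"
      by (rule XX)
    moreover have "Y 1 (X (- 1) w) = X (- 1) (Y 1 w) - H 0 w + w"
      using XY[of "-1" 1 w] by simp
    ultimately show ?case
      using f0 X H by (simp add: span_add span_diff span_base)
  next
    case (f1 w)
    have "X 0 (Y 0 w) = Y 0 (X 0 w) + H 0 w"
      using XY[of 0 0 w] by simp
    moreover have "Y 1 (Y 0 w) = Y 0 (Y 1 w)"
      by (rule YY)
    ultimately show ?case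
      using f1 Y H by (simp add: span_add)
  qed
  show "X 0 w \<in> ?W" if "w \<in> ?W" for w
    using span_closed[OF lin_X _ that] e by blast
  show "Y 1 w \<in> ?W" if "w \<in> ?W" for w
    using span_closed[OF lin_Y _ that] e by blast
qed (rule subspace_span)

text \<open>
  \<open>4 d + h\<close> lowers the words by \<open>2\<close> per letter, so the product below kills words of
  degree \<open>-2, \<dots>, -2M\<close> but not \<open>v\<close>, which has degree \<open>0\<close>.
\<close>

primrec degree_filter :: "nat \<Rightarrow> 'v \<Rightarrow> 'v"
  where "degree_filter 0 w = w"
  | "degree_filter (Suc M) w = smul 4 (D (degree_filter M w)) + H 0 (degree_filter M w)
      + smul (2 * of_nat (Suc M)) (degree_filter M w)"

lemma lin_degree_filter: "lin (degree_filter M)"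
proof (induction M)
  case 0
  show ?case by (rule linI) simp_all
next
  case (Suc M)
  show ?case
    by (rule linI) (simp_all add: lin.linear_add[OF Suc] lin.linear_scale[OF Suc] lin.linear_add[OF lin_D]
        lin.linear_scale[OF lin_D] lin.linear_add[OF lin_H] lin.linear_scale[OF lin_H] algebra_simps)
qed

lemma degree_filter_eigen:
  assumes "H 0 w = smul a w" "D w = smul b w"
  shows "degree_filter M w = smul (\<Prod>i<M. 4 * b + a + 2 * of_nat (Suc i)) w"
proof (induction M)
  case (Suc M)
  show ?case
    by (simp add: Suc lin.linear_scale[OF lin_D] lin.linear_scale[OF lin_H] assms
        scale_left_distrib[symmetric] del: of_nat_Suc) (simp add: algebra_simps del: of_nat_Suc)
qed simp

text \<open>All words have degree at most \<open>-2 m\<close>, below the degree 0 of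
  \<open>v\<close>. So \<open>v\<close> is not in their span, and irreducibility makes this
  submodule zero.\<close>

lemma singular_zero:
  assumes sing: "X 0 u = 0" "Y 1 u = 0" and wt: "H 0 u = smul a u" "D u = smul b u"
    and deg: "4 * b + a = - 2 * of_nat m" "0 < m"
  shows "u = 0"
proof -
  have mono: "degree_filter M' w = 0" if "degree_filter M w = 0" "M \<le> M'" for M M' w
    using that(2,1) by (induction rule: dec_induct)
      (simp_all add: lin.linear_0[OF lin_D] lin.linear_0[OF lin_H])
  have "v \<notin> span (words u)"
  proof
    assume v: "v \<in> span (words u)"
    have sub: "subspace {w. \<exists>M. degree_filter M w = 0}"
    proof (rule subspaceI; clarsimp)
      show "\<exists>M. degree_filter M 0 = 0"
        using lin.linear_0[OF lin_degree_filter] by blast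
      show "\<exists>M. degree_filter M (smul s w) = 0" if "degree_filter M w = 0" for s w M
        using lin.linear_scale[OF lin_degree_filter] that by (metis scale_zero_right)
      show "\<exists>M. degree_filter M (w + z) = 0" if "degree_filter M w = 0" "degree_filter M' z = 0" for w z M M'
        using mono[OF that(1), of "max M M'"] mono[OF that(2), of "max M M'"]
        by (intro exI[of _ "max M M'"]) (simp add: lin.linear_add[OF lin_degree_filter])
    qed
    have "\<exists>M. degree_filter M w = 0" if "w \<in> words u" for w
    proof -
      from words_weight[OF wt that] obtain a' b' n where
        *: "H 0 w = smul a' w" "D w = smul b' w" "4 * b' + a' = 4 * b + a - 2 * of_nat n"
        by blast
      \<comment> \<open>A word of \<open>n\<close> letters has degree \<open>-2 (m + n)\<close>, so
        the last factor is zero; \<open>0 < m\<close> keeps \<open>m + n - 1\<close> exact.\<close>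
      have "4 * b' + a' + 2 * of_nat (Suc (m + n - 1)) = 0"
        using *(3) deg by (simp add: of_nat_diff)
      then have "(\<Prod>i<m + n. 4 * b' + a' + 2 * of_nat (Suc i)) = 0"
        using deg(2) by (intro prod_zero) (auto intro!: bexI[of _ "m + n - 1"])
      then have "degree_filter (m + n) w = 0"
        using degree_filter_eigen[OF *(1,2)] by simp
      then show ?thesis by blast
    qed
    with span_induct[OF v sub] obtain M where "degree_filter M v = 0" by auto
    moreover have "degree_filter M v = smul (\<Prod>i<M. 4 * 0 + 0 + 2 * of_nat (Suc i)) v"
      by (rule degree_filter_eigen) (simp_all add: weight_v)
    ultimately show False
      using nonzero by (auto simp del: of_nat_Suc)
  qed
  then have "span (words u) = {0}"
    using irreducible[OF submodule_span_words[OF sing wt]] by blast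
  then show "u = 0"
    using span_base[OF words.base[of u]] by simp
qed

text \<open>The words in \<open>v\<close> span a submodule containing \<open>v\<close>, hence
  everything, and \<open>W\<close> contains all of them.\<close>

lemma generated_f:
  assumes "subspace W" "v \<in> W" "\<And>w. w \<in> W \<Longrightarrow> X (- 1) w \<in> W" "\<And>w. w \<in> W \<Longrightarrow> Y 0 w \<in> W"
  shows "W = UNIV"
proof -
  have "submodule (span (words v))"
    by (rule submodule_span_words[of v 0 0]) (simp_all add: e1_annihilates e0_annihilates weight_v)
  then have "span (words v) = UNIV"
    by (rule generates) (intro span_base words.base)
  moreover have "words v \<subseteq> W"
  proof
    fix w assume "w \<in> words v"
    then show "w \<in> W" by induction (use assms in auto)
  qed
  then have "span (words v) \<subseteq> W"
    by (rule span_minimal[OF _ assms(1)])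
  ultimately show ?thesis by auto
qed

text \<open>\<open>f_1 v\<close> is singular because \<open>h v = 0\<close>; its degree is
  -2.\<close>

lemma Y0_v: "Y 0 v = 0"
proof (rule singular_zero[where a = "-2" and b = 0 and m = 1])
  show "X 0 (Y 0 v) = 0"
    using XY[of 0 0 v] by (simp add: e1_annihilates weight_v lin.linear_0[OF lin_Y])
  show "Y 1 (Y 0 v) = 0"
    using YY[of 1 0 v] by (simp add: e0_annihilates lin.linear_0[OF lin_Y])
qed (simp_all add: HY DY weight_v lin.linear_0[OF lin_Y])

text \<open>\<open>f_0^2 v\<close> is singular because the highest weight takes the value 1 on
  \<open>c - h\<close>; its degree is -4.\<close>

lemma XX_v: "X (- 1) (X (- 1) v) = 0"
proof (rule singular_zero[where a = 4 and b = "-2" and m = 2])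
  have 1: "Y 1 (X (- 1) w) = X (- 1) (Y 1 w) - H 0 w + w" for w
    using XY[of "-1" 1 w] by simp
  have 2: "H 0 (X (- 1) v) = smul 2 (X (- 1) v)" "D (X (- 1) v) = - X (- 1) v"
    by (simp_all add: HX DX weight_v lin.linear_0[OF lin_X])
  have 3: "smul 2 w = w + w" for w
    using scale_left_distrib[of 1 1] by simp
  show "X 0 (X (- 1) (X (- 1) v)) = 0"
    by (simp add: XX[of 0] e1_annihilates lin.linear_0[OF lin_X])
  show "Y 1 (X (- 1) (X (- 1) v)) = 0"
    by (simp add: 1 2 3 e0_annihilates weight_v lin.linear_0[OF lin_X])
  show "H 0 (X (- 1) (X (- 1) v)) = smul 4 (X (- 1) (X (- 1) v))"
    using HX[of 0 "-1" "X (- 1) v"] unfolding 2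
    by (simp add: lin.linear_scale[OF lin_X] scale_left_distrib[symmetric])
  show "D (X (- 1) (X (- 1) v)) = smul (- 2) (X (- 1) (X (- 1) v))"
    using DX[of "-1" "X (- 1) v"] unfolding 2 by (simp add: 3 lin.linear_neg[OF lin_X])
qed simp_all

sublocale basic smul X Y H v
proof
  \<comment> \<open>Brackets with \<open>H 1\<close>, which kills \<open>v\<close>, raise the mode
    by one, so the vanishing of \<open>X 0 v\<close> and \<open>Y 0 v\<close> propagates
    upwards.\<close>
  have H1: "H 1 v = 0"
    using XY[of 0 1 v] by (simp add: e1_annihilates e0_annihilates lin.linear_0[OF lin_X] lin.linear_0[OF lin_Y])
  have X: "X (int n) v = 0" for n
  proof (induction n)
    case (Suc n)
    then show ?case
      using HX[of 1 "int n" v] by (simp add: H1 lin.linear_0[OF lin_X] lin.linear_0[OF lin_H])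
  qed (simp add: e1_annihilates)
  have Y: "Y (int n) v = 0" for n
  proof (induction n)
    case (Suc n)
    then show ?case
      using HY[of 1 "int n" v] by (simp add: H1 lin.linear_0[OF lin_Y] lin.linear_0[OF lin_H])
  qed (simp add: Y0_v)
  fix k :: int assume k: "0 \<le> k"
  show "X k v = 0" "Y k v = 0"
    using X[of "nat k"] Y[of "nat k"] k by simp_all
  then show "H k v = 0"
    using XY[of 0 k v] by (cases "k = 0")
      (simp_all add: weight_v e1_annihilates lin.linear_0[OF lin_X] lin.linear_0[OF lin_Y])
next
  fix W
  assume "subspace W" "v \<in> W" "\<And>k u. u \<in> W \<Longrightarrow> X k u \<in> W" "\<And>k u. u \<in> W \<Longrightarrow> Y k u \<in> W"
  then show "W = UNIV"
    by (rule generated_f)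
next
  show "X (- 1) (X (- 1) v) = 0"
    by (rule XX_v)
qed

end

section \<open>Stable triples and the vectors \<open>w\<^sub>n\<close>\<close>

lemma part_le_part_size: "is_partition lam \<Longrightarrow> lam i \<le> part_size lam"
  unfolding is_partition_def part_size_def
  by (cases "lam i = 0") (auto intro: member_le_sum)

text \<open>Both triples have the same \<open>m_0\<close>. By stability no part exceeds
  \<open>min (n - k) k\<close>, so all later factors are \<open>0! = 1\<close>.\<close>

lemma prod_mult_stable:
  assumes "(n, k, lam) \<in> PP_stab n"
  shows "(\<Prod>j=0..n - k. fact (mult (2 * (n - k), n - k, lam) j)) =
    (\<Prod>j=0..k. fact (mult (n, k, lam) j) :: complex)"
proof -
  let ?f = "\<lambda>j. fact (mult (n, k, lam) j) :: complex"
  have lam: "is_partition lam" and size: "part_size lam \<le> min (n - k) k" and k: "k \<le> n"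
    using assms by (auto simp: PP_stab_def PP_def)
  have "?f j = 1" if "min (n - k) k < j" for j
  proof -
    have "{i. lam i = j} = {}"
      using part_le_part_size[OF lam] size that by (metis (mono_tags) empty_Collect_eq leD le_trans)
    with that show ?thesis by simp
  qed
  then have *: "(\<Prod>j=0..K. ?f j) = (\<Prod>j=0..min (n - k) k. ?f j)" if "min (n - k) k \<le> K" for K
    using that by (intro prod.mono_neutral_right) auto
  have "(\<Prod>j=0..n - k. fact (mult (2 * (n - k), n - k, lam) j)) = (\<Prod>j=0..n - k. ?f j)"
    by (intro prod.cong) auto
  also have "\<dots> = (\<Prod>j=0..k. ?f j)"
    using *[of "n - k"] *[of k] by simp
  finally show ?thesis .
qed

text \<open>The first part is at most the size, hence at most \<open>n - k\<close>.\<close>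

lemma dagger_stable: "(n, k, lam) \<in> PP_stab n \<Longrightarrow> (2 * (n - k), n - k, lam) \<in> PP_stab (2 * (n - k))"
  using part_le_part_size[of lam 0] by (auto simp: PP_stab_def PP_def)

lemma zcoeff_dagger:
  assumes "(n, k, lam) \<in> PP_stab n"
  shows "zcoeff (n, k, lam) =
    (-1) ^ (n div 4) * (-1) ^ ((n - k) div 2) * zcoeff (2 * (n - k), n - k, lam)"
proof -
  have sign: "(-1) powi (int a - int b) = ((-1) ^ a * (-1) ^ b :: complex)" for a b
    by (simp add: power_int_diff flip: power_int_of_nat) (simp add: minus_one_power_iff)
  \<comment> \<open>The two floors in the sign of the second triple agree, so its sign is 1.\<close>
  have "2 * (n - k) div 4 = (2 * (n - k) - (n - k)) div 2"
    by simp
  then show ?thesis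
    unfolding zcoeff.simps prod_mult_stable[OF assms] sign by (simp add: mult_ac flip: power_add mult_2)
qed

section \<open>The operators and vectors of the statement\<close>

context basic_affine_module
begin

lemma refl_op_eq: "refl_op smul act 1 k = refl k" "refl_op smul act (- 1) k = refl' k"
  by (simp_all add: fun_eq_iff refl_op_def root_vec_def refl_def level_one.refl_def[OF swap])

lemma transl_op_eq: "transl_op smul act b = int_translation b"
proof -
  have "basic_transl smul act 1 = translation"
    by (simp add: fun_eq_iff basic_transl_def refl_op_eq translation_def)
  moreover have "basic_transl smul act (- 1) = translation'"
    by (simp add: fun_eq_iff basic_transl_def refl_op_eq level_one.translation_def[OF swap])
  ultimately show ?thesis
    by (simp add: transl_op_def int_translation_def)
qed

lemma wvec_eq: "wvec smul act v (2 * N) = smul ((-1) ^ (N div 2)) ((translation ^^ N) v)"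
  by (simp add: wvec_def extremal_eq)

text \<open>The signs square to 1 and both sides become \<open>T^N v\<close>, since the exponents
  \<open>2 N - k\<close> and \<open>k - N\<close> add up to \<open>N\<close>.\<close>

lemma wvec_transl:
  assumes "k \<le> 2 * N"
  shows "smul ((-1) ^ (N div 2)) (wvec smul act v (2 * N)) =
    smul ((-1) ^ ((2 * N - k) div 2))
      (int_translation (int k - int N) (wvec smul act v (2 * (2 * N - k))))"
proof -
  have "int (2 * N - k) + (int k - int N) = int N"
    using assms by simp
  then have "int_translation (int k - int N) ((translation ^^ (2 * N - k)) v) = (translation ^^ N) v"
    by (simp add: int_translation_funpow)
  then show ?thesis
    by (simp add: wvec_eq lin.linear_scale[OF lin_int_translation] flip: power_add mult_2)
qed

lemma int_translation_foldr:
  "int_translation b (foldr (\<lambda>i. Y (l - f i)) is u) = foldr (\<lambda>i. Y (l + 2 * b - f i)) is (int_translation b u)"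
  by (induction "is") (simp_all add: int_translation_Y algebra_simps)

lemma lin_foldr_Y: "lin (foldr (\<lambda>i. Y (g i)) is)"
proof (induction "is")
  case Nil
  show ?case by (rule linI) simp_all
next
  case (Cons i "is")
  then show ?case
    by (intro linI) (simp_all add: lin.linear_add lin.linear_scale lin.linear_add[OF lin_Y] lin.linear_scale[OF lin_Y])
qed

text \<open>The translation shifts each mode by \<open>2 (k - N)\<close>, turning
  \<open>2 N - k - lam i\<close> into \<open>k - lam i\<close>; the sign it needs on the
  \<open>w\<close> vectors is the one split off by \<open>zcoeff_dagger\<close>.\<close>

lemma cvec_transl:
  assumes "(2 * N, k, lam) \<in> PP_stab (2 * N)"
  shows "cvec smul act v (2 * N, k, lam) = int_translation (int k - int N)
    (cvec smul act v (2 * (2 * N - k), 2 * N - k, lam))"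
proof -
  let ?m = "2 * N - k" and ?T = "int_translation (int k - int N)"
  let ?z = "zcoeff (2 * ?m, ?m, lam)" and ?s = "(-1) ^ (N div 2) :: complex" and ?t = "(-1) ^ (?m div 2) :: complex"
  let ?F = "foldr (\<lambda>i. Y (int k - int (lam i))) [0..<?m]"
  have k: "k \<le> 2 * N"
    using assms by (auto simp: PP_stab_def PP_def)
  then have shift: "int ?m + 2 * (int k - int N) = int k"
    by simp
  have len: "2 * ?m - ?m = ?m"
    by simp
  have "smul ?s (wvec smul act v (2 * N)) = smul ?t (?T (wvec smul act v (2 * ?m)))"
    by (rule wvec_transl[OF k])
  then have w: "smul ?t (smul ?s (wvec smul act v (2 * N))) = ?T (wvec smul act v (2 * ?m))"
    by (simp flip: power_add mult_2)
  have z: "zcoeff (2 * N, k, lam) = ?s * ?t * ?z"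
    using zcoeff_dagger[OF assms] by simp
  have "cvec smul act v (2 * N, k, lam) = smul (?s * ?t * ?z) (?F (wvec smul act v (2 * N)))"
    unfolding cvec.simps z ..
  also have "\<dots> = smul ?z (?F (smul ?t (smul ?s (wvec smul act v (2 * N)))))"
    by (simp only: lin.linear_scale[OF lin_foldr_Y] scale_scale mult_ac)
  also have "\<dots> = ?T (cvec smul act v (2 * ?m, ?m, lam))"
    unfolding w cvec.simps lin.linear_scale[OF lin_int_translation] len int_translation_foldr shift ..
  finally show ?thesis .
qed

end

theorem proposition13:
  fixes smul :: "complex \<Rightarrow> 'v::ab_group_add \<Rightarrow> 'v"
    and act :: "aff \<Rightarrow> 'v \<Rightarrow> 'v"
    and v :: 'v
    and n :: nat
  assumes "irreducible_highest_weight_module smul act Lambda0 v"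
    and "even n"
  shows "wvec smul act v n =
      smul ((-1) ^ (n div 4)) (transl_op smul act (int (n div 2)) v) \<and>
    (\<forall>k\<le>n.
      smul ((-1) ^ (n div 4)) (wvec smul act v n) =
      smul ((-1) ^ ((n - k) div 2))
        (transl_op smul act (int k - int (n div 2)) (wvec smul act v (2 * (n - k))))) \<and>
    (\<forall>k lam. (n, k, lam) \<in> PP_stab n \<longrightarrow>
      (2 * (n - k), n - k, lam) \<in> PP_stab (2 * (n - k)) \<and>
      cvec smul act v (n, k, lam) =
      transl_op smul act (int k - int (n div 2)) (cvec smul act v (2 * (n - k), n - k, lam)))"
proof -
  interpret basic_affine_module smul act v
    by (rule basic_affine_module.intro[OF assms(1)])
  from assms(2) obtain N where n: "n = 2 * N" by blast
  have N: "2 * N div 4 = N div 2" "2 * N div 2 = N"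
    by simp_all
  show ?thesis
    unfolding n N transl_op_eq
  proof (intro conjI allI impI)
    show "wvec smul act v (2 * N) = smul ((-1) ^ (N div 2)) (int_translation (int N) v)"
      by (simp add: wvec_eq int_translation_def)
  qed (rule wvec_transl cvec_transl dagger_stable; assumption)+
qed

end
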